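(* For every integer $n\ge 1$: $$\overline{N}(0,2,n)>\overline{N}(1,2,n)\quad\text{if } n \text{ is odd},$$ $$\overline{N}(0,2,n)<\overline{N}(1,2,n)\quad\text{if } n \text{ is even}.$$
   Context: An overpartition of a positive integer $n$ is a partition of $n$ (a non-increasing sequence of positive integers with sum $n$) in which the first occurrence of each distinct part may or may not be overlined; thus a partition with $d$ distinct part sizes gives rise to $2^d$ overpartitions. The rank of an overpartition is its largest part minus its number of parts (overlines are ignored). $\overline{N}(a,c,n)$ denotes the number of overpartitions of $n$ whose rank is congruent to $a$ modulo $c$. *)

theory Defs
  imports Main "HOL-Number_Theory.Cong"
begin

text \<open>
  An overpartition is a list of pairs: the size of a part, and whether that part is overlined.
\<close>

definition is_overpartition :: "nat \<Rightarrow> (nat \<times> bool) list \<Rightarrow> bool" where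
  "is_overpartition n p \<longleftrightarrow>
     sorted_wrt (\<ge>) (map fst p) \<and>
     (\<forall>k \<in> set (map fst p). k > 0) \<and>
     sum_list (map fst p) = n \<and>
     (\<forall>i < length p. snd (p ! i) \<longrightarrow> (\<forall>j < i. fst (p ! j) \<noteq> fst (p ! i)))"

text \<open>Only meaningful for nonempty lists, since \<^term>\<open>Max {}\<close> is unspecified.\<close>

definition overpartition_rank :: "(nat \<times> bool) list \<Rightarrow> int" where
  "overpartition_rank p = int (Max (set (map fst p))) - int (length p)"

definition Nbar :: "int \<Rightarrow> int \<Rightarrow> nat \<Rightarrow> nat" where
  "Nbar a c n = card {p. is_overpartition n p \<and> [overpartition_rank p = a] (mod c)}"

lemma finite_overpartitions: "finite {p. is_overpartition n p}"
proof (rule finite_subset)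
  show "{p. is_overpartition n p} \<subseteq> {p. set p \<subseteq> {..n} \<times> UNIV \<and> length p \<le> n}"
  proof (intro subsetI CollectI conjI)
    fix p x assume p: "p \<in> {p. is_overpartition n p}" and "x \<in> set p"
    then have "fst x \<in> set (map fst p)" by simp
    then have "fst x \<le> sum_list (map fst p)" by (intro member_le_sum_list) simp_all
    with p show "x \<in> {..n} \<times> UNIV" by (cases x) (simp add: is_overpartition_def)
  next
    fix p assume p: "p \<in> {p. is_overpartition n p}"
    have "length q \<le> sum_list q" if "\<forall>k \<in> set q. k > 0" for q :: "nat list"
      using that by (induction q) auto
    from this[of "map fst p"] p show "length p \<le> n" by (simp add: is_overpartition_def)
  qed
  show "finite {p. set p \<subseteq> {..n} \<times> (UNIV :: bool set) \<and> length p \<le> n}"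
    by (rule finite_lists_length_le) simp
qed

end

theory Submission
  imports Defs "HOL-Computational_Algebra.Formal_Laurent_Series"
begin

text \<open>
  Weight an overpartition of rank \<open>r\<close> by \<open>(-1)\<^sup>r\<close>. Splitting by the largest part \<open>m\<close>, and writing
  \<open>R\<^sub>m\<close> for the product of \<open>(1 - q\<^sup>j) / (1 + q\<^sup>j)\<close> over \<open>j \<le> m\<close>, the generating function of the
  weighted count is \<open>1 + \<Sum>\<^sub>m (-1)\<^sup>m (R\<^sub>m - R\<^bsub>m-1\<^esub>)\<close>. After the substitution \<open>q = -x\<close> the theorem says
  that all coefficients of positive degree are negative.

  The limit of \<open>R\<^sub>m\<close> is the theta series \<open>\<theta> = \<Sum>\<^sub>s x\<^bsup>s^2\<^esup>\<close>. The q-binomial theorem and a first-order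
  recurrence show that \<open>\<theta>\<close> times the generating function is the Appell-type sum
  \<open>1 + 8 \<Sum>\<^sub>r (-1)\<^sup>r q\<^bsup>r^2+r\<^esup> / (1 + q\<^sup>r)\<^sup>2\<close>. On the other hand let \<open>S\<close> be the sum over \<open>w > 0\<close> of
  \<open>2 g\<^sub>w (1 + \<Sum> x\<^bsup>w^2-t^2\<^esup>) - 2\<close>, where \<open>\<bar>t\<bar> < w\<close> and \<open>g\<^sub>w = (1 + x\<^bsup>2w\<^esup>) / (1 - x\<^bsup>2w\<^esup>)\<close>. Summing over \<open>t\<close> first
  turns \<open>\<theta> S\<close> into a double sum over \<open>w, p > 0\<close> of \<open>2 (x\<^bsup>(w-p)^2\<^esup> - x\<^bsup>(w+p)^2\<^esup>) g\<^sub>w g\<^sub>p\<close> plus a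
  single sum. For a fixed value of \<open>w - p\<close> or \<open>w + p\<close> the addition theorem of the hyperbolic cotangent
  makes it telescope, and \<open>\<theta> (1 - S)\<close> comes out as the same Appell-type sum. Hence
  the generating function equals \<open>1 - S\<close>, and the coefficients of \<open>S\<close> are visibly positive.

  Infinite sums are avoided: all identities between series are congruences modulo \<open>x\<^sup>K\<close>.
\<close>

section \<open>Finite q-series identities\<close>

lemma sum_atLeast1_telescope:
  fixes f g :: "nat \<Rightarrow> 'a::ab_group_add"
  assumes "\<And>r. r < n \<Longrightarrow> g (Suc r) = f (Suc r) - f r"
  shows "(\<Sum>r=1..n. g r) = f n - f 0"
proof -
  have "(\<Sum>r=1..n. g r) = (\<Sum>r<n. g (Suc r))"
    by (simp add: sum.atLeast1_atMost_eq)
  also have "\<dots> = (\<Sum>r<n. f (Suc r) - f r)"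
    using assms by simp
  finally show ?thesis by (simp add: sum_lessThan_telescope)
qed

text \<open>With \<open>(q)\<^sub>n = (1 - q) \<cdots> (1 - q\<^sup>n)\<close> and \<open>(-q)\<^sub>n = (1 + q) \<cdots> (1 + q\<^sup>n)\<close>, this is \<open>(q)\<^sub>n / (-q)\<^sub>n\<close>.\<close>

definition theta_ratio :: "'a::field \<Rightarrow> nat \<Rightarrow> 'a" where
  "theta_ratio q n = (\<Prod>j=1..n. (1 - q ^ j) / (1 + q ^ j))"

text \<open>
  This is \<open>(q)\<^sub>n (q)\<^sub>n / ((q)\<^bsub>n-r\<^esub> (q)\<^bsub>n+r\<^esub>)\<close>. For \<open>n < r\<close> it is \<open>0\<close>,
  because of the factor for \<open>i = n\<close>.
\<close>

definition central_ratio :: "'a::field \<Rightarrow> nat \<Rightarrow> nat \<Rightarrow> 'a" where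
  "central_ratio q n r = (\<Prod>i<r. (1 - q ^ (n - i)) / (1 - q ^ (n + i + 1)))"

text \<open>A finite version of the Appell-type sum. For fixed \<open>r\<close> the factor
  \<open>central_ratio q n r\<close> tends to 1 as \<open>n\<close> grows; it gives the truncation
  an exact recurrence in \<open>n\<close>.\<close>

definition appell_sum :: "'a::field \<Rightarrow> nat \<Rightarrow> 'a" where
  "appell_sum q n = 1 + 8 * (\<Sum>r=1..n. (-1) ^ r * q ^ (r\<^sup>2 + r) / (1 + q ^ r)\<^sup>2 * central_ratio q n r)"

context
  fixes q :: "'a::field"
  assumes q_minus: "\<And>k. k > 0 \<Longrightarrow> 1 - q ^ k \<noteq> 0"
    and q_plus: "\<And>k. k > 0 \<Longrightarrow> 1 + q ^ k \<noteq> 0"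
begin

lemma theta_ratio_0 [simp]: "theta_ratio q 0 = 1"
  by (simp add: theta_ratio_def)

lemma theta_ratio_Suc:
  "theta_ratio q (Suc n) = theta_ratio q n * ((1 - q ^ Suc n) / (1 + q ^ Suc n))"
  by (simp add: theta_ratio_def)

lemma theta_ratio_nonzero: "theta_ratio q n \<noteq> 0"
  using q_minus q_plus by (auto simp: theta_ratio_def)

lemma central_ratio_0 [simp]: "central_ratio q n 0 = 1"
  by (simp add: central_ratio_def)

lemma central_ratio_eq_0: "n < r \<Longrightarrow> central_ratio q n r = 0"
  by (auto simp: central_ratio_def intro!: bexI[of _ n])

lemma central_ratio_Suc_right:
  "central_ratio q n (Suc r) * (1 - q ^ (n + r + 1)) = central_ratio q n r * (1 - q ^ (n - r))"
  using q_minus[of "n + r + 1"] by (simp add: central_ratio_def)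

text \<open>Read off from the quotient form \<open>(q)_n (q)_n / ((q)_(n-r) (q)_(n+r))\<close>; the
  induction on \<open>r\<close> avoids these products. For \<open>r = Suc n\<close> both sides are
  0.\<close>

lemma central_ratio_Suc_left:
  assumes "r \<le> Suc n"
  shows "(1 - q ^ Suc n)\<^sup>2 * central_ratio q n r =
         (1 - q ^ (Suc n - r)) * (1 - q ^ (Suc n + r)) * central_ratio q (Suc n) r"
  using assms
proof (induction r)
  case 0
  show ?case by (simp add: power2_eq_square)
next
  case (Suc r)
  have nz: "1 - q ^ (n + r + 1) \<noteq> 0" "1 - q ^ (Suc n + r + 1) \<noteq> 0"
    by (rule q_minus; simp)+
  have "(1 - q ^ Suc n)\<^sup>2 * central_ratio q n (Suc r) * (1 - q ^ (n + r + 1)) =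
        (1 - q ^ Suc n)\<^sup>2 * central_ratio q n r * (1 - q ^ (n - r))"
    using central_ratio_Suc_right[of n r] by (simp add: mult.assoc)
  also have "\<dots> = (1 - q ^ (Suc n - r)) * (1 - q ^ (Suc n + r)) * central_ratio q (Suc n) r * (1 - q ^ (n - r))"
    using Suc by simp
  also have "\<dots> = (1 - q ^ (n - r)) * (1 - q ^ (n + r + 1)) *
      (central_ratio q (Suc n) r * (1 - q ^ (Suc n - r)))"
    by (simp add: algebra_simps)
  also have "\<dots> = (1 - q ^ (n - r)) * (1 - q ^ (n + r + 1)) *
      (central_ratio q (Suc n) (Suc r) * (1 - q ^ (Suc n + r + 1)))"
    by (simp only: central_ratio_Suc_right)
  finally show ?case using nz by (simp add: ac_simps)
qed

text \<open>The factor \<open>q ^ r\<close> clears the truncated subtraction in the exponent. With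
  \<open>y = q ^ Suc n\<close> and \<open>z = q ^ r\<close> the bracket equals both
  \<open>(1 - y)^2 z - y (1 - z)^2\<close> and \<open>(1 + y)^2 z - y (1 + z)^2\<close>; these forms
  cancel the denominators in \<open>finite_macmahon\<close> and
  \<open>appell_sum_step\<close>.\<close>

lemma central_ratio_step_mult:
  assumes "r \<le> Suc n"
  shows "q ^ r * ((1 - q ^ Suc n)\<^sup>2 * central_ratio q n r) =
     ((1 + q ^ (2 * Suc n)) * q ^ r - q ^ Suc n * (1 + q ^ (2 * r))) * central_ratio q (Suc n) r"
proof -
  have *: "q ^ (Suc n - r) * q ^ r = q ^ Suc n"
    using assms by (simp flip: power_add)
  have "q ^ r * ((1 - q ^ (Suc n - r)) * (1 - q ^ (Suc n + r))) =
     q ^ r - q ^ (Suc n - r) * q ^ r - q ^ r * (q ^ Suc n * q ^ r) + q ^ (Suc n - r) * q ^ r * (q ^ Suc n * q ^ r)"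
    unfolding power_add by algebra
  also have "\<dots> = (1 + q ^ (2 * Suc n)) * q ^ r - q ^ Suc n * (1 + q ^ (2 * r))"
    unfolding * mult_2 power_add by algebra
  finally show ?thesis
    using central_ratio_Suc_left[OF assms] by (simp add: mult.assoc [symmetric])
qed

section \<open>Finite theta, Euler and MacMahon identities\<close>

lemma theta_telescope:
  "(\<Sum>r=1..n. (-1) ^ r * q ^ (r\<^sup>2 - r) * (1 + q ^ (2 * r) - 2 * q ^ n * q ^ r) * central_ratio q n r) = q ^ n - 1"
proof -
  \<comment> \<open>Boundary values: \<open>f n = 0\<close> because of the factor
    \<open>1 - q ^ (n - n)\<close>, and \<open>f 0 = 1 - q ^ n\<close>.\<close>
  define f where "f r = (-1) ^ r * q ^ (r\<^sup>2 + r) * (central_ratio q n r * (1 - q ^ (n - r)))" for r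
  have "(\<Sum>r=1..n. (-1) ^ r * q ^ (r\<^sup>2 - r) * (1 + q ^ (2 * r) - 2 * q ^ n * q ^ r) * central_ratio q n r) = f n - f 0"
  proof (rule sum_atLeast1_telescope)
    fix r assume "r < n"
    have 1: "q ^ (n - Suc r) * q ^ Suc r = q ^ n"
      using \<open>r < n\<close> by (simp flip: power_add del: power_Suc)
    have 2: "(Suc r)\<^sup>2 - Suc r = r\<^sup>2 + r" "(Suc r)\<^sup>2 + Suc r = (r\<^sup>2 + r) + Suc r + Suc r"
      by (simp_all add: power2_eq_square)
    have fS: "f (Suc r) = - ((-1) ^ r * q ^ (r\<^sup>2 + r) * central_ratio q n (Suc r) * (q ^ Suc r * (q ^ Suc r - q ^ (n - Suc r) * q ^ Suc r)))"
      unfolding f_def 2 power_add by (simp add: algebra_simps)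
    have fr: "f r = (-1) ^ r * q ^ (r\<^sup>2 + r) * central_ratio q n (Suc r) * (1 - q ^ n * q ^ Suc r)"
      unfolding f_def central_ratio_Suc_right [symmetric] by (simp add: power_add)
    show "(-1) ^ Suc r * q ^ ((Suc r)\<^sup>2 - Suc r) * (1 + q ^ (2 * Suc r) - 2 * q ^ n * q ^ Suc r) * central_ratio q n (Suc r)
      = f (Suc r) - f r"
      unfolding fS fr 1 2 mult_2 power_add by (simp add: algebra_simps)
  qed
  thus ?thesis
    by (simp add: f_def)
qed

text \<open>A finite form of Gauss's identity for the alternating theta series. By
  \<open>central_ratio_step_mult\<close>, \<open>(1 - y)^2 S_n - (1 - y^2) S_(n+1)\<close> is
  \<open>- y\<close> times the sum of \<open>theta_telescope\<close>, so \<open>1 + 2 S_n\<close>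
  obeys the recurrence of \<open>theta_ratio\<close>.\<close>

lemma finite_theta:
  "1 + 2 * (\<Sum>r=1..n. (-1) ^ r * q ^ r\<^sup>2 * central_ratio q n r) = theta_ratio q n"
proof (induction n)
  case (Suc n)
  define y where "y = q ^ Suc n"
  have y2: "q ^ (2 * Suc n) = y\<^sup>2"
    by (simp add: y_def mult_2 power_add power2_eq_square)
  have *: "q ^ r\<^sup>2 = q ^ (r\<^sup>2 - r) * q ^ r" for r
    by (simp add: power2_eq_square flip: power_add)
  define S where "S m k = (\<Sum>r=1..k. (-1) ^ r * q ^ r\<^sup>2 * central_ratio q m r)" for m k
  have "(1 - y)\<^sup>2 * S n (Suc n) - (1 - y\<^sup>2) * S (Suc n) (Suc n) =
    - y * (\<Sum>r=1..Suc n. (-1) ^ r * q ^ (r\<^sup>2 - r) * (1 + q ^ (2 * r) - 2 * y * q ^ r) * central_ratio q (Suc n) r)"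
    unfolding S_def sum_distrib_left sum_subtractf [symmetric]
  proof (rule sum.cong)
    fix r assume "r \<in> {1..Suc n}"
    hence r: "q ^ r * ((1 - y)\<^sup>2 * central_ratio q n r) =
      ((1 + y\<^sup>2) * q ^ r - y * (1 + q ^ (2 * r))) * central_ratio q (Suc n) r"
      using central_ratio_step_mult[of r n] unfolding y2 unfolding y_def [symmetric] by auto
    have "(1 - y)\<^sup>2 * ((-1) ^ r * q ^ r\<^sup>2 * central_ratio q n r) =
      (-1) ^ r * q ^ (r\<^sup>2 - r) * (q ^ r * ((1 - y)\<^sup>2 * central_ratio q n r))"
      unfolding * by (simp add: algebra_simps)
    thus "(1 - y)\<^sup>2 * ((-1) ^ r * q ^ r\<^sup>2 * central_ratio q n r) -
         (1 - y\<^sup>2) * ((-1) ^ r * q ^ r\<^sup>2 * central_ratio q (Suc n) r) =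
         - y * ((-1) ^ r * q ^ (r\<^sup>2 - r) * (1 + q ^ (2 * r) - 2 * y * q ^ r) * central_ratio q (Suc n) r)"
      unfolding r * by (simp add: algebra_simps power2_eq_square)
  qed simp
  also have "\<dots> = y * (1 - y)"
    unfolding y_def theta_telescope by (simp add: algebra_simps)
  finally have "(1 - y) * ((1 + y) * (1 + 2 * S (Suc n) (Suc n))) = (1 - y) * ((1 - y) * (1 + 2 * S n (Suc n)))"
    by algebra
  hence "(1 + y) * (1 + 2 * S (Suc n) (Suc n)) = (1 - y) * (1 + 2 * S n (Suc n))"
    using q_minus[of "Suc n"] by (simp add: y_def)
  hence "1 + 2 * S (Suc n) (Suc n) = (1 + 2 * S n (Suc n)) * ((1 - y) / (1 + y))"
    using q_plus[of "Suc n"] by (simp add: y_def eq_divide_eq mult.commute)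
  also have "S n (Suc n) = S n n"
    by (simp add: S_def central_ratio_eq_0)
  also have "1 + 2 * S n n = theta_ratio q n"
    using Suc.IH by (simp add: S_def)
  finally show ?case
    by (simp add: S_def theta_ratio_Suc y_def)
qed simp

text \<open>Multiplied by \<open>1 - q ^ n\<close> the sum telescopes; dividing by this factor at
  the end requires \<open>n > 0\<close>. The identity supplies the induction step of
  \<open>finite_macmahon\<close>.\<close>

lemma finite_euler:
  assumes "n > 0"
  shows "(\<Sum>r=1..n. (-1) ^ Suc r * q ^ (r * (r - 1) div 2) * (1 + q ^ r) * central_ratio q n r) = 1"
proof -
  define f where "f r = (-1) ^ Suc r * q ^ (r * (r + 1) div 2) * (central_ratio q n r * (1 - q ^ (n - r)))" for r
  have "(\<Sum>r=1..n. (1 - q ^ n) * ((-1) ^ Suc r * q ^ (r * (r - 1) div 2) * (1 + q ^ r) * central_ratio q n r)) = f n - f 0"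
  proof (rule sum_atLeast1_telescope)
    fix r assume "r < n"
    have 1: "q ^ (n - Suc r) * q ^ Suc r = q ^ n"
      using \<open>r < n\<close> by (simp flip: power_add del: power_Suc)
    have "Suc r * (Suc r + 1) = r * (r + 1) + 2 * Suc r"
      by simp
    hence 2: "Suc r * (Suc r + 1) div 2 = r * (r + 1) div 2 + Suc r"
      by simp
    have 3: "Suc r * (Suc r - 1) div 2 = r * (r + 1) div 2"
      by (simp add: mult.commute)
    have fS: "f (Suc r) = (-1) ^ r * q ^ (r * (r + 1) div 2) * central_ratio q n (Suc r) * (q ^ Suc r - q ^ (n - Suc r) * q ^ Suc r)"
      unfolding f_def 2 power_add by (simp add: algebra_simps)
    have fr: "f r = - ((-1) ^ r * q ^ (r * (r + 1) div 2) * central_ratio q n (Suc r) * (1 - q ^ n * q ^ Suc r))"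
      unfolding f_def central_ratio_Suc_right [symmetric] by (simp add: power_add)
    show "(1 - q ^ n) * ((-1) ^ Suc (Suc r) * q ^ (Suc r * (Suc r - 1) div 2) * (1 + q ^ Suc r) * central_ratio q n (Suc r))
      = f (Suc r) - f r"
      unfolding fS fr 1 3 by (simp add: algebra_simps)
  qed
  hence "(1 - q ^ n) * (\<Sum>r=1..n. (-1) ^ Suc r * q ^ (r * (r - 1) div 2) * (1 + q ^ r) * central_ratio q n r) = 1 - q ^ n"
    by (simp add: f_def sum_distrib_left)
  thus ?thesis using q_minus[OF assms] by simp
qed

text \<open>From \<open>n\<close> to \<open>n + 1\<close>, the increment of the central ratio times
  \<open>q^r (1 - y)^2\<close> is \<open>y (1 - q^r)^2\<close> times the new ratio. The square
  cancels the denominator, the sum of \<open>finite_euler\<close> remains, and the left side grows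
  by exactly \<open>y / (1 - y)^2\<close>.\<close>

lemma finite_macmahon:
  "(\<Sum>r=1..n. (-1) ^ Suc r * q ^ (r * (r + 1) div 2) * (1 + q ^ r) / (1 - q ^ r)\<^sup>2 * central_ratio q n r) =
   (\<Sum>j=1..n. q ^ j / (1 - q ^ j)\<^sup>2)"
proof (induction n)
  case (Suc n)
  define y where "y = q ^ Suc n"
  have y2: "q ^ (2 * Suc n) = y\<^sup>2"
    by (simp add: y_def mult_2 power_add power2_eq_square)
  have y: "1 - y \<noteq> 0"
    unfolding y_def by (rule q_minus; simp)
  define a where "a r = (-1) ^ Suc r * q ^ (r * (r + 1) div 2) * (1 + q ^ r) / (1 - q ^ r)\<^sup>2" for r
  have *: "(1 - y)\<^sup>2 * (a r * central_ratio q (Suc n) r - a r * central_ratio q n r) =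
    y * ((-1) ^ Suc r * q ^ (r * (r - 1) div 2) * (1 + q ^ r) * central_ratio q (Suc n) r)"
    if r: "r \<in> {1..Suc n}" for r
  proof -
    have nz: "(1 - q ^ r)\<^sup>2 \<noteq> 0" using q_minus[of r] r by simp
    obtain s where s: "r = Suc s" using r by (cases r) auto
    have "Suc s * (Suc s + 1) = r * (r - 1) + 2 * r"
      by (simp add: s)
    hence "r * (r + 1) div 2 = r * (r - 1) div 2 + r"
      by (simp add: s)
    hence a: "a r = (-1) ^ Suc r * q ^ (r * (r - 1) div 2) * (1 + q ^ r) / (1 - q ^ r)\<^sup>2 * q ^ r"
      unfolding a_def by (simp add: power_add)
    have "q ^ r * ((1 - y)\<^sup>2 * (central_ratio q (Suc n) r - central_ratio q n r)) =
      (1 - y)\<^sup>2 * q ^ r * central_ratio q (Suc n) r - q ^ r * ((1 - y)\<^sup>2 * central_ratio q n r)"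
      by (simp add: algebra_simps)
    also have "q ^ r * ((1 - y)\<^sup>2 * central_ratio q n r) =
      ((1 + y\<^sup>2) * q ^ r - y * (1 + q ^ (2 * r))) * central_ratio q (Suc n) r"
      using central_ratio_step_mult[of r n] r unfolding y2 unfolding y_def [symmetric] by simp
    also have "(1 - y)\<^sup>2 * q ^ r * central_ratio q (Suc n) r - \<dots> = (1 - q ^ r)\<^sup>2 * (y * central_ratio q (Suc n) r)"
      unfolding mult_2 [of r] power_add by algebra
    finally have b: "q ^ r * ((1 - y)\<^sup>2 * (central_ratio q (Suc n) r - central_ratio q n r)) = \<dots>" .
    have "(1 - y)\<^sup>2 * (a r * central_ratio q (Suc n) r - a r * central_ratio q n r) =
      (-1) ^ Suc r * q ^ (r * (r - 1) div 2) * (1 + q ^ r) / (1 - q ^ r)\<^sup>2 *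
      (q ^ r * ((1 - y)\<^sup>2 * (central_ratio q (Suc n) r - central_ratio q n r)))"
      unfolding a by (simp only: right_diff_distrib mult.assoc mult.left_commute mult.commute)
    also have "\<dots> = y * ((-1) ^ Suc r * q ^ (r * (r - 1) div 2) * (1 + q ^ r) * central_ratio q (Suc n) r)"
      unfolding b using nz by (simp add: field_simps)
    finally show ?thesis .
  qed
  have "(1 - y)\<^sup>2 * ((\<Sum>r=1..Suc n. a r * central_ratio q (Suc n) r) - (\<Sum>r=1..Suc n. a r * central_ratio q n r)) =
     (\<Sum>r=1..Suc n. (1 - y)\<^sup>2 * (a r * central_ratio q (Suc n) r - a r * central_ratio q n r))"
    by (simp only: sum_subtractf [symmetric] sum_distrib_left)
  also have "\<dots> = (\<Sum>r=1..Suc n. y * ((-1) ^ Suc r * q ^ (r * (r - 1) div 2) * (1 + q ^ r) * central_ratio q (Suc n) r))"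
    by (rule sum.cong[OF refl], rule *)
  also have "\<dots> = y"
    unfolding sum_distrib_left [symmetric] finite_euler[OF zero_less_Suc] by simp
  finally have "(\<Sum>r=1..Suc n. a r * central_ratio q (Suc n) r) =
    (\<Sum>r=1..Suc n. a r * central_ratio q n r) + y / (1 - y)\<^sup>2"
    using y by (simp add: field_simps del: sum.cl_ivl_Suc)
  also have "(\<Sum>r=1..Suc n. a r * central_ratio q n r) = (\<Sum>r=1..n. a r * central_ratio q n r)"
    by (simp add: central_ratio_eq_0)
  also have "\<dots> = (\<Sum>j=1..n. q ^ j / (1 - q ^ j)\<^sup>2)"
    using Suc.IH by (simp add: a_def)
  finally show ?case
    by (simp add: a_def y_def)
qed simp

text \<open>The second form of the bracket in \<open>central_ratio_step_mult\<close> produces a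
  factor \<open>(1 + q^r)^2\<close>. It cancels the denominators and leaves the summands of
  \<open>finite_theta\<close>.\<close>

lemma appell_sum_step:
  "(1 + q ^ Suc n)\<^sup>2 * appell_sum q (Suc n) =
   (1 - q ^ Suc n)\<^sup>2 * appell_sum q n + 4 * q ^ Suc n * theta_ratio q (Suc n)"
proof -
  define y where "y = q ^ Suc n"
  have y2: "q ^ (2 * Suc n) = y\<^sup>2"
    by (simp add: y_def mult_2 power_add power2_eq_square)
  define a where "a r = (-1) ^ r * q ^ (r\<^sup>2 + r) / (1 + q ^ r)\<^sup>2" for r
  have *: "(1 + y)\<^sup>2 * (a r * central_ratio q (Suc n) r) - (1 - y)\<^sup>2 * (a r * central_ratio q n r) =
    y * ((-1) ^ r * q ^ r\<^sup>2 * central_ratio q (Suc n) r)"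
    if r: "r \<in> {1..Suc n}" for r
  proof -
    have nz: "(1 + q ^ r)\<^sup>2 \<noteq> 0" using q_plus[of r] r by simp
    have a: "a r = (-1) ^ r * q ^ r\<^sup>2 / (1 + q ^ r)\<^sup>2 * q ^ r"
      unfolding a_def by (simp add: power_add)
    have "q ^ r * ((1 + y)\<^sup>2 * central_ratio q (Suc n) r - (1 - y)\<^sup>2 * central_ratio q n r) =
      (1 + y)\<^sup>2 * q ^ r * central_ratio q (Suc n) r - q ^ r * ((1 - y)\<^sup>2 * central_ratio q n r)"
      by (simp add: algebra_simps)
    also have "q ^ r * ((1 - y)\<^sup>2 * central_ratio q n r) =
      ((1 + y\<^sup>2) * q ^ r - y * (1 + q ^ (2 * r))) * central_ratio q (Suc n) r"
      using central_ratio_step_mult[of r n] r unfolding y2 unfolding y_def [symmetric] by simp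
    also have "(1 + y)\<^sup>2 * q ^ r * central_ratio q (Suc n) r - \<dots> = (1 + q ^ r)\<^sup>2 * (y * central_ratio q (Suc n) r)"
      unfolding mult_2 [of r] power_add by algebra
    finally have b: "q ^ r * ((1 + y)\<^sup>2 * central_ratio q (Suc n) r - (1 - y)\<^sup>2 * central_ratio q n r) = \<dots>" .
    have "(1 + y)\<^sup>2 * (a r * central_ratio q (Suc n) r) - (1 - y)\<^sup>2 * (a r * central_ratio q n r) =
      (-1) ^ r * q ^ r\<^sup>2 / (1 + q ^ r)\<^sup>2 *
      (q ^ r * ((1 + y)\<^sup>2 * central_ratio q (Suc n) r - (1 - y)\<^sup>2 * central_ratio q n r))"
      unfolding a by (simp add: algebra_simps)
    also have "\<dots> = y * ((-1) ^ r * q ^ r\<^sup>2 * central_ratio q (Suc n) r)"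
      unfolding b using nz by (simp add: field_simps)
    finally show ?thesis .
  qed
  have "(1 + y)\<^sup>2 * (\<Sum>r=1..Suc n. a r * central_ratio q (Suc n) r) - (1 - y)\<^sup>2 * (\<Sum>r=1..Suc n. a r * central_ratio q n r) =
     (\<Sum>r=1..Suc n. (1 + y)\<^sup>2 * (a r * central_ratio q (Suc n) r) - (1 - y)\<^sup>2 * (a r * central_ratio q n r))"
    by (simp only: sum_subtractf sum_distrib_left)
  also have "\<dots> = (\<Sum>r=1..Suc n. y * ((-1) ^ r * q ^ r\<^sup>2 * central_ratio q (Suc n) r))"
    by (rule sum.cong[OF refl], rule *)
  also have "\<dots> = y * (\<Sum>r=1..Suc n. (-1) ^ r * q ^ r\<^sup>2 * central_ratio q (Suc n) r)"
    by (simp only: sum_distrib_left)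
  also have "(\<Sum>r=1..Suc n. a r * central_ratio q n r) = (\<Sum>r=1..n. a r * central_ratio q n r)"
    by (simp add: central_ratio_eq_0)
  finally have **: "(1 + y)\<^sup>2 * (\<Sum>r=1..Suc n. a r * central_ratio q (Suc n) r) =
      (1 - y)\<^sup>2 * (\<Sum>r=1..n. a r * central_ratio q n r) +
      y * (\<Sum>r=1..Suc n. (-1) ^ r * q ^ r\<^sup>2 * central_ratio q (Suc n) r)"
    by (simp only: algebra_simps)
  \<comment> \<open>The constants 1 and 8 fit together: \<open>(1 + y)^2 - (1 - y)^2 = 4 y\<close>
    completes \<open>8 y U\<close> to \<open>4 y (1 + 2 U)\<close>, and \<open>1 + 2 U\<close> is
    \<open>theta_ratio\<close>.\<close>
  have "(1 + y)\<^sup>2 * (1 + 8 * S) = (1 - y)\<^sup>2 * (1 + 8 * T) + 4 * y * (1 + 2 * U)"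
    if "(1 + y)\<^sup>2 * S = (1 - y)\<^sup>2 * T + y * U" for S T U :: 'a
  proof -
    have "(1 + y)\<^sup>2 * (1 + 8 * S) = (1 + y)\<^sup>2 + 8 * ((1 + y)\<^sup>2 * S)"
      by (simp add: algebra_simps)
    thus ?thesis unfolding that by (simp add: algebra_simps power2_eq_square)
  qed
  from this[OF **] show ?thesis
    unfolding finite_theta appell_sum_def y_def a_def .
qed

text \<open>Variation of constants: the square of \<open>theta_ratio\<close> solves the homogeneous
  part of \<open>appell_sum_step\<close>, and the sum collects the inhomogeneous terms.\<close>

lemma appell_sum_eq:
  "appell_sum q n =
   (theta_ratio q n)\<^sup>2 * (1 + 4 * (\<Sum>j=1..n. q ^ j / ((1 + q ^ j)\<^sup>2 * theta_ratio q j)))"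
proof (induction n)
  case (Suc n)
  define y where "y = q ^ Suc n"
  have y: "1 - y \<noteq> 0" "1 + y \<noteq> 0"
    using q_minus[of "Suc n"] q_plus[of "Suc n"] by (simp_all add: y_def)
  define R where "R = theta_ratio q (Suc n)"
  have R: "R = theta_ratio q n * ((1 - y) / (1 + y))" "R \<noteq> 0"
    unfolding R_def y_def by (rule theta_ratio_Suc theta_ratio_nonzero)+
  define S where "S = 1 + 4 * (\<Sum>j=1..n. q ^ j / ((1 + q ^ j)\<^sup>2 * theta_ratio q j))"
  have "(1 + y)\<^sup>2 * appell_sum q (Suc n) = (1 - y)\<^sup>2 * ((theta_ratio q n)\<^sup>2 * S) + 4 * y * R"
    unfolding y_def R_def S_def appell_sum_step Suc.IH ..
  also have "(1 - y)\<^sup>2 * ((theta_ratio q n)\<^sup>2 * S) = ((1 + y) * R)\<^sup>2 * S"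
    using y by (simp add: R(1) power_mult_distrib power_divide)
  also have "\<dots> + 4 * y * R = (1 + y)\<^sup>2 * (R\<^sup>2 * (S + 4 * y / ((1 + y)\<^sup>2 * R)))"
  proof -
    define u where "u = 4 * y / ((1 + y)\<^sup>2 * R)"
    have "u * ((1 + y)\<^sup>2 * R) = 4 * y"
      using y R(2) by (simp add: u_def)
    thus ?thesis unfolding u_def [symmetric] by algebra
  qed
  finally have "appell_sum q (Suc n) = R\<^sup>2 * (S + 4 * y / ((1 + y)\<^sup>2 * R))"
    using y by simp
  thus ?case
    unfolding R_def [symmetric] by (simp add: S_def y_def R_def algebra_simps del: power_Suc)
qed (simp add: appell_sum_def)

end

section \<open>Congruences between Laurent series\<close>

text \<open>Laurent series form a field, so quotients can be written freely; congruences modulo a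
  power of \<open>fls_X\<close> make sense relative to this subring of series without negative
  exponents.\<close>

definition power_series :: "'a::field fls set" where
  "power_series = range fps_to_fls"

definition X_cong :: "nat \<Rightarrow> 'a::field fls \<Rightarrow> 'a fls \<Rightarrow> bool" where
  "X_cong k f g \<longleftrightarrow> (\<exists>h \<in> power_series. f - g = fls_X ^ k * h)"

named_theorems power_series_intros
named_theorems nome_intros

lemma power_series_fps [power_series_intros]: "fps_to_fls f \<in> power_series"
  by (simp add: power_series_def)

lemma power_series_0 [power_series_intros]: "0 \<in> power_series"
  using power_series_fps[of 0] by simp

lemma power_series_1 [power_series_intros]: "1 \<in> power_series"
  using power_series_fps[of 1] by simp

lemma power_series_X [power_series_intros]: "fls_X \<in> power_series"
  using power_series_fps[of fps_X] by simp

lemma power_series_numeral [power_series_intros]: "numeral n \<in> power_series"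
  using power_series_fps[of "numeral n"] by simp

lemma power_series_add [power_series_intros]:
  "f \<in> power_series \<Longrightarrow> g \<in> power_series \<Longrightarrow> f + g \<in> power_series"
  unfolding power_series_def by (auto simp flip: fps_to_fls_plus)

lemma power_series_minus [power_series_intros]: "f \<in> power_series \<Longrightarrow> - f \<in> power_series"
  unfolding power_series_def by (auto simp flip: fps_to_fls_uminus)

lemma power_series_diff [power_series_intros]:
  "f \<in> power_series \<Longrightarrow> g \<in> power_series \<Longrightarrow> f - g \<in> power_series"
  unfolding power_series_def by (auto simp flip: fps_to_fls_minus)

lemma power_series_mult [power_series_intros]:
  "f \<in> power_series \<Longrightarrow> g \<in> power_series \<Longrightarrow> f * g \<in> power_series"
  unfolding power_series_def by (auto simp flip: fls_times_fps_to_fls)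

lemma power_series_power [power_series_intros]: "f \<in> power_series \<Longrightarrow> f ^ n \<in> power_series"
  by (induction n) (auto intro: power_series_intros)

lemma power_series_sum [power_series_intros]:
  "(\<And>i. i \<in> A \<Longrightarrow> f i \<in> power_series) \<Longrightarrow> sum f A \<in> power_series"
  by (induction A rule: infinite_finite_induct) (auto intro: power_series_intros)

lemma power_series_X_powi: "n \<ge> 0 \<Longrightarrow> fls_X powi n \<in> power_series"
  by (auto simp: power_int_def intro: power_series_intros)

lemma X_cong_refl [simp, intro]: "X_cong k f f"
  by (auto simp: X_cong_def intro!: bexI[of _ 0] power_series_0)

lemma X_congI: "f - g = fls_X ^ k * h \<Longrightarrow> h \<in> power_series \<Longrightarrow> X_cong k f g"
  by (auto simp: X_cong_def)

lemma X_congE: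
  assumes "X_cong k f g"
  obtains h where "h \<in> power_series" "f = g + fls_X ^ k * h"
proof -
  obtain h where "h \<in> power_series" "f - g = fls_X ^ k * h"
    using assms by (auto simp: X_cong_def)
  thus ?thesis
    by (intro that[of h]) (auto simp: diff_eq_eq add.commute)
qed

lemma X_cong_sym: "X_cong k f g \<Longrightarrow> X_cong k g f"
  by (erule X_congE, rule X_congI[of _ _ _ "- h" for h]) (auto intro: power_series_minus)

lemma X_cong_trans [trans]: "X_cong k f g \<Longrightarrow> X_cong k g h \<Longrightarrow> X_cong k f h"
  by (elim X_congE, rule X_congI[of _ _ _ "u + v" for u v])
     (auto simp: distrib_left intro: power_series_add)

lemma X_cong_eq_trans [trans]: "X_cong k f g \<Longrightarrow> g = h \<Longrightarrow> X_cong k f h" "f = g \<Longrightarrow> X_cong k g h \<Longrightarrow> X_cong k f h"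
  by simp_all

lemma X_cong_add: "X_cong k f g \<Longrightarrow> X_cong k f' g' \<Longrightarrow> X_cong k (f + f') (g + g')"
  by (elim X_congE, rule X_congI[of _ _ _ "u + v" for u v])
     (auto simp: distrib_left intro: power_series_add)

lemma X_cong_minus: "X_cong k f g \<Longrightarrow> X_cong k (- f) (- g)"
  by (erule X_congE, rule X_congI[of _ _ _ "- h" for h]) (auto intro: power_series_minus)

lemma X_cong_diff: "X_cong k f g \<Longrightarrow> X_cong k f' g' \<Longrightarrow> X_cong k (f - f') (g - g')"
  using X_cong_add[of k f g "- f'" "- g'"] X_cong_minus[of k f' g'] by simp

lemma X_cong_mult_left: "h \<in> power_series \<Longrightarrow> X_cong k f g \<Longrightarrow> X_cong k (h * f) (h * g)"
  by (erule X_congE, rule X_congI[of _ _ _ "h * u" for u])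
     (auto simp: distrib_left ac_simps intro: power_series_mult)

lemma X_cong_mult_right: "h \<in> power_series \<Longrightarrow> X_cong k f g \<Longrightarrow> X_cong k (f * h) (g * h)"
  using X_cong_mult_left[of h k f g] by (simp add: mult.commute)

lemma X_cong_mult:
  "f \<in> power_series \<Longrightarrow> g' \<in> power_series \<Longrightarrow> X_cong k f g \<Longrightarrow> X_cong k f' g' \<Longrightarrow> X_cong k (f * f') (g * g')"
  by (rule X_cong_trans[OF X_cong_mult_left X_cong_mult_right])

lemma X_cong_sum: "(\<And>i. i \<in> A \<Longrightarrow> X_cong k (f i) (g i)) \<Longrightarrow> X_cong k (sum f A) (sum g A)"
  by (induction A rule: infinite_finite_induct) (auto intro: X_cong_add)

lemma X_cong_0I: "k \<le> n \<Longrightarrow> h \<in> power_series \<Longrightarrow> X_cong k (fls_X ^ n * h) 0"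
  unfolding X_cong_def
  by (rule bexI[of _ "fls_X ^ (n - k) * h"])
     (auto simp: mult.assoc [symmetric] simp flip: power_add intro: power_series_intros)

text \<open>A prefactor \<open>fls_X ^ n\<close> raises the precision by \<open>n\<close>, so
  cofactors need only be known to a lower order.\<close>

lemma X_cong_X_power_mult:
  assumes "X_cong m f g" "k \<le> n + m"
  shows "X_cong k (fls_X ^ n * f) (fls_X ^ n * g)"
proof -
  obtain h where h: "h \<in> power_series" "f = g + fls_X ^ m * h"
    using assms(1) by (rule X_congE)
  have "X_cong k (fls_X ^ n * g + fls_X ^ (n + m) * h) (fls_X ^ n * g + 0)"
    using assms(2) h(1) by (intro X_cong_add X_cong_refl X_cong_0I)
  thus ?thesis
    by (simp add: h(2) distrib_left power_add mult.assoc)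
qed

lemma X_cong_mono: "X_cong m f g \<Longrightarrow> k \<le> m \<Longrightarrow> X_cong k f g"
  using X_cong_X_power_mult[of m f g k 0] by simp

lemma X_cong_nth:
  assumes "X_cong k f g" "n < k"
  shows "fls_nth f (int n) = fls_nth g (int n)"
proof -
  obtain h where "f - g = fls_X ^ k * fps_to_fls h"
    using assms(1) by (auto simp: X_cong_def power_series_def)
  hence "fls_nth (f - g) (int n) = fls_nth (fls_X ^ k * fps_to_fls h) (int n)"
    by simp
  also have "\<dots> = 0"
    using assms(2) by (simp add: fls_X_power_times_conv_shift)
  finally show ?thesis by simp
qed

lemma X_cong_1_unit:
  assumes "f \<in> power_series" "X_cong 1 f 1"
  shows "f \<noteq> 0" "inverse f \<in> power_series"
proof -
  obtain h where h: "f = fps_to_fls h"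
    using assms(1) by (auto simp: power_series_def)
  have "fls_nth f 0 = 1"
    using X_cong_nth[OF assms(2), of 0] by simp
  hence h0: "fps_nth h 0 = 1"
    by (simp add: h)
  thus "f \<noteq> 0"
    by (auto simp: h)
  have "subdegree h = 0"
    using h0 by (auto intro: subdegreeI)
  thus "inverse f \<in> power_series"
    by (simp add: h fls_inverse_fps_to_fls power_series_fps)
qed

lemma power_series_divide:
  "f \<in> power_series \<Longrightarrow> g \<in> power_series \<Longrightarrow> X_cong 1 g 1 \<Longrightarrow> f / g \<in> power_series"
  unfolding divide_inverse by (intro power_series_mult X_cong_1_unit)

lemma sum_atMost_eq_plus: "(\<Sum>k\<le>n. f k) = f 0 + (\<Sum>k=1..n. f k)"
  for f :: "nat \<Rightarrow> 'a::comm_monoid_add"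
  by (induction n) (auto simp: add.assoc)

section \<open>The finite products as power series in a nome \<open>q = fls_X * u\<close>\<close>

context
  fixes q u :: "'a::field_char_0 fls"
  assumes q: "q = fls_X * u" and u: "u \<in> power_series"
begin

lemma nome_power_eq: "q ^ n = fls_X ^ n * u ^ n"
  by (simp add: q power_mult_distrib)

lemma nome_power_series [nome_intros]: "q \<in> power_series"
  unfolding q by (intro power_series_intros nome_intros u)

lemma nome_power_cong_0: "k \<le> n \<Longrightarrow> h \<in> power_series \<Longrightarrow> X_cong k (q ^ n * h) 0"
  unfolding nome_power_eq mult.assoc by (intro X_cong_0I power_series_intros nome_intros u)

lemma one_minus_nome_power_cong: "k \<le> n \<Longrightarrow> X_cong k (1 - q ^ n) 1"
  using X_cong_diff[OF X_cong_refl nome_power_cong_0[of k n 1], of 1] by (simp add: power_series_1)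

lemma one_plus_nome_power_cong: "k \<le> n \<Longrightarrow> X_cong k (1 + q ^ n) 1"
  using X_cong_add[OF X_cong_refl nome_power_cong_0[of k n 1], of 1] by (simp add: power_series_1)

lemma nome_nonzero: "n > 0 \<Longrightarrow> 1 - q ^ n \<noteq> 0" "n > 0 \<Longrightarrow> 1 + q ^ n \<noteq> 0"
  by (rule X_cong_1_unit(1); intro power_series_intros nome_intros one_minus_nome_power_cong one_plus_nome_power_cong; simp)+

lemma power_series_nome_divide [nome_intros]:
  assumes "f \<in> power_series" "n > 0"
  shows "f / (1 - q ^ n) \<in> power_series" "f / (1 + q ^ n) \<in> power_series"
        "f / (1 - q ^ n)\<^sup>2 \<in> power_series" "f / (1 + q ^ n)\<^sup>2 \<in> power_series"
proof -
  have *: "f / (1 - q ^ n) \<in> power_series" "f / (1 + q ^ n) \<in> power_series"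
    if "f \<in> power_series" for f
    using that assms(2)
    by (intro power_series_divide power_series_intros nome_intros one_minus_nome_power_cong one_plus_nome_power_cong; simp)+
  show "f / (1 - q ^ n) \<in> power_series" "f / (1 + q ^ n) \<in> power_series"
    "f / (1 - q ^ n)\<^sup>2 \<in> power_series" "f / (1 + q ^ n)\<^sup>2 \<in> power_series"
    using *(1)[OF assms(1)] *(2)[OF assms(1)] *(1)[OF *(1)[OF assms(1)]] *(2)[OF *(2)[OF assms(1)]]
    by (simp_all only: power2_eq_square divide_divide_eq_left)
qed

text \<open>The smallest exponent in the product is \<open>n - r + 1\<close>, in the last numerator;
  this is the order of the error.\<close>

lemma central_ratio_cong_1:
  assumes "r \<le> n"
  shows "X_cong (Suc n - r) (central_ratio q n r) 1 \<and> central_ratio q n r \<in> power_series"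
  using assms
proof (induction r)
  case 0
  show ?case by (simp add: central_ratio_def power_series_1)
next
  case (Suc r)
  define k where "k = Suc n - Suc r"
  define t where "t = (1 - q ^ (n - r)) / (1 - q ^ (n + r + 1))"
  have nz: "1 - q ^ (n + r + 1) \<noteq> 0"
    by (rule nome_nonzero) simp
  have t: "t \<in> power_series"
    unfolding t_def by (intro power_series_intros nome_intros) auto
  have "X_cong k ((1 - q ^ (n - r)) * inverse (1 - q ^ (n + r + 1))) ((1 - q ^ (n + r + 1)) * inverse (1 - q ^ (n + r + 1)))"
  proof (rule X_cong_mult_right)
    have "X_cong k (1 - q ^ (n - r)) 1" "X_cong k (1 - q ^ (n + r + 1)) 1"
      using Suc.prems by (intro one_minus_nome_power_cong; simp add: k_def)+
    thus "X_cong k (1 - q ^ (n - r)) (1 - q ^ (n + r + 1))"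
      using X_cong_sym X_cong_trans by blast
    show "inverse (1 - q ^ (n + r + 1)) \<in> power_series"
      by (intro X_cong_1_unit power_series_intros nome_intros one_minus_nome_power_cong) simp
  qed
  hence "X_cong k t 1"
    using nz by (simp add: t_def divide_inverse)
  moreover have "X_cong k (central_ratio q n r) 1" "central_ratio q n r \<in> power_series"
    using Suc by (auto simp: k_def intro: X_cong_mono)
  ultimately have "X_cong k (central_ratio q n r * t) (1 * 1)" "central_ratio q n r * t \<in> power_series"
    using t by (auto intro!: X_cong_mult power_series_mult power_series_1 simp del: mult_1_left mult_1_right)
  thus ?case
    by (simp add: central_ratio_def t_def k_def)
qed

lemma theta_ratio_cong_1: "X_cong 1 (theta_ratio q n) 1"
  and theta_ratio_power_series [nome_intros]: "theta_ratio q n \<in> power_series"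
proof -
  have *: "X_cong 1 (theta_ratio q n) 1 \<and> theta_ratio q n \<in> power_series"
  proof (induction n)
    case (Suc n)
    define t where "t = (1 - q ^ Suc n) / (1 + q ^ Suc n)"
    have nz: "1 + q ^ Suc n \<noteq> 0"
      by (rule nome_nonzero) simp
    have t: "t \<in> power_series"
      unfolding t_def by (intro power_series_intros nome_intros) auto
    have "X_cong 1 (1 - q ^ Suc n) 1" "X_cong 1 (1 + q ^ Suc n) 1"
      by (intro one_minus_nome_power_cong one_plus_nome_power_cong; simp)+
    hence "X_cong 1 (1 - q ^ Suc n) (1 + q ^ Suc n)"
      using X_cong_sym X_cong_trans by blast
    moreover have "inverse (1 + q ^ Suc n) \<in> power_series"
      by (intro X_cong_1_unit power_series_intros nome_intros one_plus_nome_power_cong) simp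
    ultimately have "X_cong 1 ((1 - q ^ Suc n) * inverse (1 + q ^ Suc n)) ((1 + q ^ Suc n) * inverse (1 + q ^ Suc n))"
      by (rule X_cong_mult_right [rotated])
    hence "X_cong 1 t 1"
      using nz by (simp add: t_def divide_inverse)
    hence "X_cong 1 (theta_ratio q n * t) (1 * 1)"
      using Suc.IH by (intro X_cong_mult power_series_1) auto
    moreover have "theta_ratio q n * t \<in> power_series"
      using t Suc.IH by (intro power_series_mult) auto
    moreover have "theta_ratio q (Suc n) = theta_ratio q n * t"
      by (simp add: theta_ratio_def t_def)
    ultimately show ?case by (simp only: mult_1)
  qed (auto simp: theta_ratio_def intro: power_series_1)
  show "X_cong 1 (theta_ratio q n) 1" "theta_ratio q n \<in> power_series"
    using * by blast+
qed

lemma theta_ratio_nome_nonzero: "theta_ratio q n \<noteq> 0"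
  by (rule theta_ratio_nonzero nome_nonzero | assumption)+

lemma theta_ratio_divide_power_series [nome_intros]:
  "f \<in> power_series \<Longrightarrow> f / theta_ratio q n \<in> power_series"
  by (intro power_series_divide power_series_intros nome_intros theta_ratio_cong_1)

section \<open>The q-binomial theorem and the alternating sum of theta ratios\<close>

text \<open>
  The expansion of \<open>(- q\<^sup>m; q)\<^sub>\<infinity> / (q\<^sup>m; q)\<^sub>\<infinity>\<close> given by the
  \<open>q\<close>-binomial theorem, truncated.
\<close>
definition binomial_series :: "nat \<Rightarrow> nat \<Rightarrow> 'a fls" where
  "binomial_series K m = (\<Sum>k\<le>K. 2 / (theta_ratio q k * (1 + q ^ k)) * q ^ (m * k))"

text \<open>The functional equation \<open>(1 - z) F(z) = (1 + z) F(q z)\<close> at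
  \<open>z = q ^ m\<close>, with the boundary term left by the truncation at
  \<open>K\<close>.\<close>

lemma binomial_series_step:
  "(1 - q ^ m) * binomial_series K m =
   (1 + q ^ m) * binomial_series K (Suc m) - 2 / theta_ratio q K * q ^ (m * Suc K)"
proof (induction K)
  case 0
  show ?case by (simp add: binomial_series_def theta_ratio_def)
next
  case (Suc K)
  define R where "R = theta_ratio q K"
  define y where "y = q ^ Suc K"
  have y: "1 + y \<noteq> 0" "1 - y \<noteq> 0"
    unfolding y_def by (rule nome_nonzero; simp)+
  have R: "R \<noteq> 0"
    by (simp add: R_def theta_ratio_nome_nonzero)
  have RS: "theta_ratio q (Suc K) = R * ((1 - y) / (1 + y))"
    by (simp add: R_def theta_ratio_def y_def)
  have b: "binomial_series (Suc K) m' = binomial_series K m' + 2 / (R * (1 - y)) * q ^ (m' * Suc K)" for m'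
    using y by (simp add: binomial_series_def RS y_def [symmetric] del: power_Suc)
  define p where "p = q ^ (m * Suc K)"
  have e: "q ^ (Suc m * Suc K) = p * y" "q ^ (m * Suc (Suc K)) = p * q ^ m"
    unfolding p_def y_def by (simp_all flip: power_add add: algebra_simps)
  have e1: "2 / R = 2 / (R * (1 - y)) * (1 - y)"
    by (simp only: times_divide_eq_left mult_divide_mult_cancel_right[OF y(2)])
  have e2: "(1 - Q) * (c * p) - c * (1 - y) * p = (1 + Q) * (c * (p * y)) - c * (1 + y) * (p * Q)" for Q c
    by algebra
  have d: "(1 - q ^ m) * (2 / (R * (1 - y)) * p) - 2 / R * p =
      (1 + q ^ m) * (2 / (R * (1 - y)) * (p * y)) - 2 / (R * (1 - y)) * (1 + y) * (p * q ^ m)"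
    unfolding e1 by (rule e2)
  have c: "2 / (R * ((1 - y) / (1 + y))) = 2 / (R * (1 - y)) * (1 + y)"
    using y by simp
  have comb: "A * (b + u) = A' * (b' + u') - w"
    if "A * u - v = A' * u' - w" "A * b = A' * b' - v" for A A' b b' u u' v w :: "'a fls"
  proof -
    have "A * (b + u) = A * b + (A * u - v) + v"
      by (simp add: distrib_left)
    thus ?thesis
      unfolding that by (simp add: distrib_left)
  qed
  show ?case
    unfolding b RS e p_def [symmetric] c
    by (rule comb[OF d]) (use Suc.IH in \<open>simp only: R_def p_def\<close>)
qed

text \<open>In the limit, \<open>theta_ratio q m\<close> is the full product divided by its tail
  over \<open>j > m\<close>, and the inverse of the tail is the binomial series. The induction
  descends from \<open>m = K\<close>, where every term except \<open>k = 0\<close> is divisible by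
  \<open>fls_X ^ K\<close>; in each step the boundary term of \<open>binomial_series_step\<close> is
  so too.\<close>

lemma theta_ratio_cong_binomial_series:
  assumes "m \<le> K"
  shows "X_cong K (theta_ratio q m) (theta_ratio q K * binomial_series K (Suc m))"
  using assms
proof (induction rule: inc_induct)
  case base
  have "binomial_series K (Suc K) = 1 + (\<Sum>k=1..K. 2 / (theta_ratio q k * (1 + q ^ k)) * q ^ (Suc K * k))"
    unfolding binomial_series_def by (subst sum_atMost_eq_plus) (simp add: theta_ratio_def)
  also have "X_cong K \<dots> (1 + (\<Sum>k=1..K. 0))"
  proof (intro X_cong_add X_cong_sum X_cong_refl)
    fix k assume k: "k \<in> {1..K}"
    have "2 / (1 + q ^ k) / theta_ratio q k \<in> power_series"
      using k by (intro power_series_intros nome_intros) auto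
    hence "X_cong K (q ^ (Suc K * k) * (2 / (theta_ratio q k * (1 + q ^ k)))) 0"
      using k by (intro nome_power_cong_0) (cases k, simp_all add: mult.commute)
    thus "X_cong K (2 / (theta_ratio q k * (1 + q ^ k)) * q ^ (Suc K * k)) 0"
      by (simp add: mult.commute)
  qed
  finally have "X_cong K (theta_ratio q K * binomial_series K (Suc K)) (theta_ratio q K * 1)"
    by (intro X_cong_mult_left power_series_intros nome_intros) simp_all
  thus ?case
    by (simp add: X_cong_sym)
next
  case (step m)
  define y where "y = q ^ Suc m"
  have y: "1 + y \<noteq> 0" "1 - y \<noteq> 0"
    unfolding y_def by (rule nome_nonzero; simp)+
  have "theta_ratio q m = (1 + y) / (1 - y) * theta_ratio q (Suc m)"
    using y by (simp add: theta_ratio_def y_def)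
  also have "X_cong K \<dots> ((1 + y) / (1 - y) * (theta_ratio q K * binomial_series K (Suc (Suc m))))"
    by (intro X_cong_mult_left step.IH) (auto simp: y_def intro!: power_series_intros nome_intros simp del: power_Suc)
  also have "\<dots> = theta_ratio q K * (((1 + y) * binomial_series K (Suc (Suc m))) / (1 - y))"
    by simp
  also have "(1 + y) * binomial_series K (Suc (Suc m)) = (1 - y) * binomial_series K (Suc m) + 2 / theta_ratio q K * q ^ (Suc m * Suc K)"
    using binomial_series_step[of "Suc m" K] by (simp add: y_def)
  also have "theta_ratio q K * (((1 - y) * binomial_series K (Suc m) + 2 / theta_ratio q K * q ^ (Suc m * Suc K)) / (1 - y)) =
     theta_ratio q K * binomial_series K (Suc m) + q ^ (Suc m * Suc K) * (2 / (1 - y))"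
    using y theta_ratio_nome_nonzero[of K] by (simp add: add_divide_distrib distrib_left)
  also have "X_cong K \<dots> (theta_ratio q K * binomial_series K (Suc m) + 0)"
    by (intro X_cong_add X_cong_refl nome_power_cong_0)
       (auto simp: y_def intro!: power_series_intros nome_intros simp del: power_Suc)
  finally show ?case by simp
qed

text \<open>The summand is \<open>1 / theta_ratio q k - 1 / theta_ratio q (k - 1)\<close>.\<close>

lemma inverse_theta_ratio:
  "1 + (\<Sum>k=1..n. 2 * q ^ k / ((1 + q ^ k) * theta_ratio q k)) = 1 / theta_ratio q n"
proof (induction n)
  case (Suc n)
  define R where "R = theta_ratio q n"
  define y where "y = q ^ Suc n"
  have y: "1 + y \<noteq> 0" "1 - y \<noteq> 0"
    unfolding y_def by (rule nome_nonzero; simp)+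
  have R: "R \<noteq> 0"
    by (simp add: R_def theta_ratio_nome_nonzero)
  have RS: "theta_ratio q (Suc n) = R * ((1 - y) / (1 + y))"
    by (simp add: R_def theta_ratio_def y_def)
  have "1 / R + 2 * y / ((1 + y) * (R * ((1 - y) / (1 + y)))) = 1 / (R * ((1 - y) / (1 + y)))"
    using y R by (simp add: divide_simps) (simp add: algebra_simps)?
  thus ?case
    using Suc.IH by (simp add: RS y_def [symmetric] R_def [symmetric] add.assoc [symmetric] del: power_Suc)
qed (simp add: theta_ratio_def)

text \<open>By \<open>appell_sum_eq\<close> the right side is
  \<open>appell_sum q K / theta_ratio q K\<close>. Each difference on the left is expanded by the
  binomial series; after exchanging the sums, the sum over \<open>m\<close> is geometric.\<close>

lemma alternating_theta_ratio_cong: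
  "X_cong K (1 + (\<Sum>m=1..K. (-1) ^ m * (theta_ratio q m - theta_ratio q (m - 1))))
     (theta_ratio q K * (1 + 4 * (\<Sum>j=1..K. q ^ j / ((1 + q ^ j)\<^sup>2 * theta_ratio q j))))"
proof -
  define R where "R = theta_ratio q"
  have R: "R k \<noteq> 0" for k
    by (simp add: R_def theta_ratio_nome_nonzero)
  have "X_cong K (\<Sum>m=1..K. (-1) ^ m * (R m - R (m - 1)))
    (\<Sum>m=1..K. (-1) ^ m * (R K * binomial_series K (Suc m) - R K * binomial_series K m))"
  proof (intro X_cong_sum X_cong_mult_left X_cong_diff power_series_intros nome_intros)
    fix m assume m: "m \<in> {1..K}"
    show "X_cong K (R m) (R K * binomial_series K (Suc m))"
      unfolding R_def by (rule theta_ratio_cong_binomial_series) (use m in auto)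
    show "X_cong K (R (m - 1)) (R K * binomial_series K m)"
    proof -
      have "m - 1 \<le> K" "Suc (m - 1) = m"
        using m by auto
      with theta_ratio_cong_binomial_series[of "m - 1" K] show ?thesis
        by (simp only: R_def)
    qed
  qed
  also have "\<dots> = R K * (\<Sum>m=1..K. \<Sum>k\<le>K. (-1) ^ m * (2 / (R k * (1 + q ^ k)) * (q ^ (Suc m * k) - q ^ (m * k))))"
    unfolding binomial_series_def R_def sum_distrib_left right_diff_distrib sum_subtractf
    by (simp add: sum_distrib_left ac_simps)
  also have "\<dots> = R K * (\<Sum>k\<le>K. 2 / (R k * (1 + q ^ k)) * ((q ^ k - 1) * (\<Sum>m=1..K. (- (q ^ k)) ^ m)))"
  proof -
    have *: "(-1) ^ m * (2 / (R k * (1 + q ^ k)) * (q ^ (Suc m * k) - q ^ (m * k))) =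
      2 / (R k * (1 + q ^ k)) * ((q ^ k - 1) * (- (q ^ k)) ^ m)" for m k
      by (subst power_minus) (simp add: algebra_simps power_add power_mult [symmetric] mult.commute[of m])
    show ?thesis
      unfolding * by (subst sum.swap) (simp only: sum_distrib_left)
  qed
  \<comment> \<open>The term \<open>k = 0\<close> vanishes through the factor
    \<open>q ^ k - 1\<close>. It must go first, because its geometric sum has ratio -1 and does not
    converge.\<close>
  also have "\<dots> = R K * (\<Sum>k=1..K. 2 / (R k * (1 + q ^ k)) * ((q ^ k - 1) * (\<Sum>m=1..K. (- (q ^ k)) ^ m)))"
    by (subst sum_atMost_eq_plus) simp
  also have "X_cong K \<dots> (R K * (\<Sum>k=1..K. 2 / (R k * (1 + q ^ k)) * ((q ^ k - 1) * (- (q ^ k) / (1 + q ^ k)))))"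
  proof (intro X_cong_mult_left X_cong_sum)
    show "R K \<in> power_series"
      unfolding R_def by (intro power_series_intros nome_intros)
    fix k assume k: "k \<in> {1..K}"
    hence nz: "1 + q ^ k \<noteq> 0" by (intro nome_nonzero) auto
    have "2 / (1 + q ^ k) / theta_ratio q k \<in> power_series"
      using k by (intro power_series_intros nome_intros) auto
    thus "2 / (R k * (1 + q ^ k)) \<in> power_series"
      by (simp add: R_def mult.commute)
    show "q ^ k - 1 \<in> power_series"
      by (intro power_series_intros nome_intros)
    have "(\<Sum>m=1..n. y ^ m) * (1 - y) = y - y ^ Suc n" for n and y :: "'a fls"
      by (induction n) (simp, simp add: distrib_right, simp add: algebra_simps)
    from this[of "- (q ^ k)" K] have "(\<Sum>m=1..K. (- (q ^ k)) ^ m) = (- (q ^ k) - (- (q ^ k)) ^ Suc K) / (1 + q ^ k)"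
      using nz by (simp add: field_simps)
    also have "(- (q ^ k)) ^ Suc K = q ^ (k * Suc K) * (-1) ^ Suc K"
      by (simp only: power_minus[of "q ^ k"] power_mult mult.commute)
    also have "(- (q ^ k) - q ^ (k * Suc K) * (-1) ^ Suc K) / (1 + q ^ k) =
      - (q ^ k) / (1 + q ^ k) - q ^ (k * Suc K) * ((-1) ^ Suc K / (1 + q ^ k))"
      by (simp add: diff_divide_distrib)
    also have "X_cong K \<dots> (- (q ^ k) / (1 + q ^ k) - 0)"
    proof (intro X_cong_diff X_cong_refl nome_power_cong_0 power_series_intros nome_intros)
      show "K \<le> k * Suc K" "0 < k"
        using k by (cases k; simp)+
    qed
    finally show "X_cong K (\<Sum>m=1..K. (- (q ^ k)) ^ m) (- (q ^ k) / (1 + q ^ k))"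
      by simp
  qed
  finally have "X_cong K (1 + (\<Sum>m=1..K. (-1) ^ m * (R m - R (m - 1)))) (1 + \<dots>)"
    by (rule X_cong_add [OF X_cong_refl])
  \<comment> \<open>Since \<open>2 (y - 1) (- y) = 4 y - 2 y (1 + y)\<close>, the summand splits
    into the wanted term and one that \<open>inverse_theta_ratio\<close> sums to
    \<open>1 / R K - 1\<close>.\<close>
  also have "1 + (R K * (\<Sum>k=1..K. 2 / (R k * (1 + q ^ k)) * ((q ^ k - 1) * (- (q ^ k) / (1 + q ^ k))))) =
    1 + R K * (\<Sum>k=1..K. 4 * (q ^ k / ((1 + q ^ k)\<^sup>2 * R k)) - 2 * q ^ k / ((1 + q ^ k) * R k))"
  proof -
    have *: "2 / (R k * (1 + q ^ k)) * ((q ^ k - 1) * (- (q ^ k) / (1 + q ^ k))) =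
       4 * (q ^ k / ((1 + q ^ k)\<^sup>2 * R k)) - 2 * q ^ k / ((1 + q ^ k) * R k)" if "k \<in> {1..K}" for k
    proof -
      have nz: "1 + q ^ k \<noteq> 0" using that by (intro nome_nonzero) auto
      have "2 / (r * (1 + y)) * ((y - 1) * (- y / (1 + y))) = 4 * (y / ((1 + y)\<^sup>2 * r)) - 2 * y / ((1 + y) * r)"
        if "1 + y \<noteq> 0" "r \<noteq> 0" for r y :: "'a fls"
      proof -
        have a: "2 * y / ((1 + y) * r) = 2 * y * (1 + y) / ((1 + y)\<^sup>2 * r)"
          using that by (simp add: power2_eq_square)
        have b: "2 / (r * (1 + y)) * ((y - 1) * (- y / (1 + y))) = (2 * ((y - 1) * (- y))) / ((1 + y)\<^sup>2 * r)"
          by (simp only: power2_eq_square times_divide_eq_left times_divide_eq_right divide_divide_eq_left mult.assoc mult.left_commute mult.commute)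
        have c: "2 * ((y - 1) * (- y)) = 4 * y - 2 * y * (1 + y)"
          by (simp add: algebra_simps)
        show ?thesis
          unfolding a b c by (simp add: diff_divide_distrib)
      qed
      from this[OF nz R] show ?thesis .
    qed
    have "(\<Sum>k=1..K. 2 / (R k * (1 + q ^ k)) * ((q ^ k - 1) * (- (q ^ k) / (1 + q ^ k)))) =
      (\<Sum>k=1..K. 4 * (q ^ k / ((1 + q ^ k)\<^sup>2 * R k)) - 2 * q ^ k / ((1 + q ^ k) * R k))"
      by (rule sum.cong[OF refl *])
    thus ?thesis by (simp only:)
  qed
  also have "\<dots> = R K * (1 + 4 * (\<Sum>k=1..K. q ^ k / ((1 + q ^ k)\<^sup>2 * R k)))"
  proof -
    have *: "(\<Sum>k=1..K. 2 * q ^ k / ((1 + q ^ k) * R k)) = 1 / R K - 1"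
      using inverse_theta_ratio[of K] by (simp only: R_def eq_diff_eq add.commute)
    have "1 + r * (4 * s - (1 / r - 1)) = r * (1 + 4 * s)" if "r \<noteq> 0" for r s :: "'a fls"
      using that by (simp add: right_diff_distrib distrib_left)
    from this[OF R] show ?thesis
      unfolding sum_subtractf sum_distrib_left [symmetric] * .
  qed
  finally show ?thesis
    unfolding R_def .
qed

end

section \<open>The theta function times the Hecke-type sum\<close>

lemma sum_int_symmetric:
  fixes f :: "int \<Rightarrow> 'a::comm_monoid_add"
  shows "(\<Sum>p\<in>{- int n..int n}. f p) = f 0 + (\<Sum>p=1..n. f (int p) + f (- int p))"
proof (induction n)
  case (Suc n)
  have "{- int (Suc n)..int (Suc n)} = insert (int (Suc n)) (insert (- int (Suc n)) {- int n..int n})"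
    by auto
  thus ?case
    using Suc by (simp add: ac_simps)
qed simp

lemma sum_int_telescope:
  fixes f :: "int \<Rightarrow> 'a::ab_group_add"
  shows "(\<Sum>t\<in>{a..<a + int n}. f t - f (t + 1)) = f a - f (a + int n)"
proof (induction n)
  case (Suc n)
  have "{a..<a + int (Suc n)} = insert (a + int n) {a..<a + int n}"
    by auto
  thus ?case
    using Suc by (simp add: algebra_simps)
qed simp

text \<open>With \<open>a = exp (- 2 u)\<close> and \<open>b = exp (- 2 v)\<close> this is
  \<open>coth u coth v + 1 = coth (u + v) (coth u + coth v)\<close>.\<close>

lemma coth_addition:
  fixes a b :: "'a::field"
  assumes "1 - a \<noteq> 0" "1 - b \<noteq> 0" "1 - a * b \<noteq> 0"
  shows "(1 + a) / (1 - a) * ((1 + b) / (1 - b)) =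
      (1 + a * b) / (1 - a * b) * ((1 + a) / (1 - a) + (1 + b) / (1 - b)) - 1"
proof -
  have cancel: "c / e * (2 * e / f) = 2 * c / f" if "e \<noteq> 0" for c e f :: 'a
    using that by simp
  have *: "(1 + a) / (1 - a) + (1 + b) / (1 - b) = 2 * (1 - a * b) / ((1 - a) * (1 - b))"
    using assms by (simp add: add_frac_eq) (simp add: algebra_simps)
  have "(1 + a * b) / (1 - a * b) * ((1 + a) / (1 - a) + (1 + b) / (1 - b)) =
     2 * (1 + a * b) / ((1 - a) * (1 - b))"
    unfolding * by (rule cancel[OF assms(3)])
  moreover have "(1 + a) / (1 - a) * ((1 + b) / (1 - b)) + 1 = 2 * (1 + a * b) / ((1 - a) * (1 - b))"
    using assms by (simp add: add_divide_eq_iff divide_add_eq_iff) (simp add: algebra_simps)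
  ultimately show ?thesis by (simp add: eq_diff_eq)
qed
text \<open>The same law for two arguments of known difference:
  \<open>coth u coth (u + v) = 1 + coth v (coth u - coth (u + v))\<close>.\<close>

lemma coth_subtraction:
  fixes a b :: "'a::field"
  assumes "1 - a \<noteq> 0" "1 - b \<noteq> 0" "1 - a * b \<noteq> 0"
  shows "(1 + a) / (1 - a) * ((1 + a * b) / (1 - a * b)) =
    1 + (1 + b) / (1 - b) * ((1 + a) / (1 - a) - (1 + a * b) / (1 - a * b))"
proof -
  have cancel: "c / e * (2 * a * e / f) = 2 * a * c / f" if "e \<noteq> 0" for c e f :: 'a
    using that by simp
  have *: "(1 + a) / (1 - a) - (1 + a * b) / (1 - a * b) = 2 * a * (1 - b) / ((1 - a) * (1 - a * b))"
    using assms by (simp add: diff_frac_eq) (simp add: algebra_simps)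
  have "(1 + b) / (1 - b) * ((1 + a) / (1 - a) - (1 + a * b) / (1 - a * b)) =
     2 * a * (1 + b) / ((1 - a) * (1 - a * b))"
    unfolding * by (rule cancel[OF assms(2)])
  moreover have "(1 + a) / (1 - a) * ((1 + a * b) / (1 - a * b)) - 1 = 2 * a * (1 + b) / ((1 - a) * (1 - a * b))"
    using assms by (simp add: diff_divide_eq_iff divide_diff_eq_iff) (simp add: algebra_simps)
  ultimately show ?thesis by (simp add: diff_eq_eq add.commute)
qed
lemma coth_inverse:
  fixes y :: "'a::field"
  assumes "y \<noteq> 0" "1 - y \<noteq> 0"
  shows "(1 + inverse y) / (1 - inverse y) = - ((1 + y) / (1 - y))"
proof -
  have "1 + inverse y = (1 + y) / y" "1 - inverse y = - (1 - y) / y"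
    using assms by (simp_all add: divide_inverse algebra_simps)
  thus ?thesis
    using assms by (simp del: minus_diff_eq)
qed

section \<open>Truncated theta function, cotangent series and inner theta sums\<close>

context
  fixes x :: "'a::field_char_0 fls"
  defines "x \<equiv> fls_X"
begin

lemma x_nonzero [simp]: "x \<noteq> 0"
  by (simp add: x_def)

lemma x_power_series: "x \<in> power_series"
  by (simp add: x_def power_series_X)

lemma x_powi_power_series: "n \<ge> 0 \<Longrightarrow> x powi n \<in> power_series"
  unfolding x_def by (rule power_series_X_powi)

lemma x_power_cong_0: "k \<le> n \<Longrightarrow> h \<in> power_series \<Longrightarrow> X_cong k (x ^ n * h) 0"
  by (simp add: x_def X_cong_0I)

lemma x_powi_square_cong_0:
  assumes "int K \<le> \<bar>s\<bar>" "h \<in> power_series"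
  shows "X_cong K (x powi s\<^sup>2 * h) 0"
proof -
  have "\<bar>s\<bar> \<le> \<bar>s\<bar> * \<bar>s\<bar>"
    using mult_left_mono[of 1 "\<bar>s\<bar>" "\<bar>s\<bar>"] by (cases "s = 0") auto
  hence "int K \<le> s\<^sup>2"
    using assms(1) by (simp add: power2_eq_square)
  hence "X_cong K (x ^ nat (s\<^sup>2) * h) 0"
    using assms(2) by (intro x_power_cong_0) auto
  thus ?thesis
    by (simp add: power_int_def)
qed

lemma x_powi_nat_square: "x powi ((int d)\<^sup>2) = x ^ d\<^sup>2"
  by (simp flip: of_nat_power)

definition theta_sum :: "nat \<Rightarrow> 'a fls" where
  "theta_sum K = (\<Sum>s\<in>{- int K..int K}. x powi s\<^sup>2)"

lemma theta_sum_eq: "theta_sum K = 1 + 2 * (\<Sum>d=1..K. x ^ d\<^sup>2)"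
  unfolding theta_sum_def sum_int_symmetric
  by (simp add: x_powi_nat_square sum.distrib sum_distrib_left)

lemma theta_sum_cong:
  assumes "a \<le> - int K" "int K \<le> b"
  shows "X_cong K (\<Sum>s\<in>{a..b}. x powi s\<^sup>2) (theta_sum K)"
proof -
  have *: "{a..b} = {- int K..int K} \<union> ({a..b} - {- int K..int K})"
    using assms by auto
  have "(\<Sum>s\<in>{a..b}. x powi s\<^sup>2) = theta_sum K + (\<Sum>s\<in>{a..b} - {- int K..int K}. x powi s\<^sup>2)"
    by (subst *, subst sum.union_disjoint) (auto simp: theta_sum_def)
  also have "X_cong K \<dots> (theta_sum K + (\<Sum>s\<in>{a..b} - {- int K..int K}. 0))"
  proof (intro X_cong_add X_cong_refl X_cong_sum)
    fix s assume "s \<in> {a..b} - {- int K..int K}"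
    hence "int K \<le> \<bar>s\<bar>" by auto
    from x_powi_square_cong_0[OF this power_series_1] show "X_cong K (x powi s\<^sup>2) 0"
      by simp
  qed
  finally show ?thesis by simp
qed

definition coth_series :: "nat \<Rightarrow> 'a fls" where
  "coth_series w = (1 + x ^ (2 * w)) / (1 - x ^ (2 * w))"

text \<open>The two end terms count one half.\<close>
definition inner_theta :: "nat \<Rightarrow> 'a fls" where
  "inner_theta w = (\<Sum>t\<in>{- int w..<int w}. (x powi (- t\<^sup>2) + x powi (- (t + 1)\<^sup>2)) / 2)"

lemma x_power_nonzero: "n > 0 \<Longrightarrow> 1 - x ^ n \<noteq> 0"
  using nome_nonzero(1)[of x 1 n] by (simp add: x_def power_series_1)

lemma coth_series_power_series: "w > 0 \<Longrightarrow> coth_series w \<in> power_series"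
  unfolding coth_series_def
  by (intro power_series_nome_divide(1)[of x 1] power_series_intros x_power_series) (auto simp: x_def)

text \<open>The exponents are linear in \<open>t\<close>, so this is a geometric sum with ratio
  \<open>y = x powi (2 * p)\<close>. Averaging neighbours yields the factor
  \<open>(1 + y) / (1 - y)\<close>, and at the ends \<open>t = - w\<close> and \<open>t = w\<close>
  the exponent is a perfect square.\<close>

lemma inner_theta_summand:
  fixes p :: int
  assumes "p \<noteq> 0"
  shows "(\<Sum>t\<in>{- int w..<int w}. (x powi ((int w)\<^sup>2 + p\<^sup>2 + 2 * p * t) + x powi ((int w)\<^sup>2 + p\<^sup>2 + 2 * p * (t + 1))) / 2) =
    (x powi ((int w - p)\<^sup>2) - x powi ((int w + p)\<^sup>2)) * ((1 + x powi (2 * p)) / (1 - x powi (2 * p))) / 2"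
proof -
  define y where "y = x powi (2 * p)"
  have y: "1 - y \<noteq> 0"
  proof
    assume "1 - y = 0"
    have *: "x ^ n = 1 \<Longrightarrow> n = 0" for n
      using x_power_nonzero[of n] by (cases n) auto
    show False
    proof (cases "p > 0")
      case True
      thus ?thesis
        using *[of "nat (2 * p)"] \<open>1 - y = 0\<close> by (simp add: y_def power_int_def)
    next
      case False
      thus ?thesis
        using *[of "nat (- 2 * p)"] \<open>1 - y = 0\<close> assms by (simp add: y_def power_int_def power_inverse split: if_splits)
    qed
  qed
  define F where "F t = x powi ((int w)\<^sup>2 + p\<^sup>2 + 2 * p * t)" for t
  have F: "F (t + 1) = y * F t" for t
    by (simp add: F_def y_def ring_distribs add_ac flip: power_int_add)
  have "(1 - y) * ((u + y * u) / 2) = (u - y * u) * ((1 + y) / 2)" for u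
    by (simp add: algebra_simps)
  hence "(1 - y) * (\<Sum>t\<in>{- int w..<int w}. (F t + F (t + 1)) / 2) =
    (\<Sum>t\<in>{- int w..<- int w + int (2 * w)}. F t - F (t + 1)) * ((1 + y) / 2)"
    unfolding sum_distrib_left sum_distrib_right F by (intro sum.cong) auto
  also have "\<dots> = (F (- int w) - F (int w)) * ((1 + y) / 2)"
    by (subst sum_int_telescope) simp
  also have "F (- int w) = x powi ((int w - p)\<^sup>2)"
    by (simp add: F_def power2_eq_square algebra_simps)
  also have "F (int w) = x powi ((int w + p)\<^sup>2)"
    by (simp add: F_def power2_eq_square algebra_simps)
  finally have eq: "(1 - y) * (\<Sum>t\<in>{- int w..<int w}. (F t + F (t + 1)) / 2) =
    (x powi ((int w - p)\<^sup>2) - x powi ((int w + p)\<^sup>2)) * ((1 + y) / 2)" .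
  have "S = D * ((1 + y) / (1 - y)) / 2" if "(1 - y) * S = D * ((1 + y) / 2)" for S D
  proof -
    have "S = (1 - y) * S / (1 - y)"
      using y by simp
    thus ?thesis
      unfolding that by simp
  qed
  from this[OF eq] show ?thesis
    unfolding F_def y_def .
qed

text \<open>Writing the theta index as \<open>p + t\<close> turns the exponent
  \<open>(p + t)^2 + w^2 - t^2\<close> into one linear in \<open>t\<close>. For \<open>p = 0\<close>
  there are \<open>2 w\<close> equal terms; \<open>p\<close> and \<open>- p\<close> contribute
  equally because the cotangent is odd (\<open>coth_inverse\<close>).\<close>

lemma theta_sum_times_inner_theta:
  "X_cong K (theta_sum K * (x ^ w\<^sup>2 * inner_theta w))
     (2 * of_nat w * x ^ w\<^sup>2 +
      (\<Sum>p=1..w + K. (x powi ((int w - int p)\<^sup>2) - x powi ((int w + int p)\<^sup>2)) * coth_series p))"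
proof -
  \<comment> \<open>The margin \<open>w\<close> ensures that the range still covers
    \<open>- K\<close> to \<open>K\<close> after a shift by any \<open>t\<close> between
    \<open>- w\<close> and \<open>w\<close>.\<close>
  define P where "P = {- int (w + K)..int (w + K)}"
  define e where "e p t = x powi ((int w)\<^sup>2 + p\<^sup>2 + 2 * p * t)" for p t :: int
  have xw: "x ^ w\<^sup>2 = x powi ((int w)\<^sup>2)"
    by (simp flip: of_nat_power)
  have *: "X_cong K (theta_sum K * x powi ((int w)\<^sup>2 - t\<^sup>2)) (\<Sum>p\<in>P. e p t)"
    if t: "t \<in> {- int w..int w}" for t
  proof -
    have "X_cong K (\<Sum>s\<in>{- int (w + K) + t..int (w + K) + t}. x powi s\<^sup>2) (theta_sum K)"
      using t by (intro theta_sum_cong) auto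
    also have "(\<Sum>s\<in>{- int (w + K) + t..int (w + K) + t}. x powi s\<^sup>2) = (\<Sum>p\<in>P. x powi ((p + t)\<^sup>2))"
      by (rule sum.reindex_bij_witness[of _ "\<lambda>p. p + t" "\<lambda>s. s - t"]) (auto simp: P_def)
    finally have "X_cong K (theta_sum K * x powi ((int w)\<^sup>2 - t\<^sup>2)) ((\<Sum>p\<in>P. x powi ((p + t)\<^sup>2)) * x powi ((int w)\<^sup>2 - t\<^sup>2))"
    proof (intro X_cong_mult_right x_powi_power_series)
      have "\<bar>t\<bar> \<le> \<bar>int w\<bar>" using t by auto
      hence "t\<^sup>2 \<le> (int w)\<^sup>2" by (simp only: abs_le_square_iff)
      thus "(int w)\<^sup>2 - t\<^sup>2 \<ge> 0" by simp
    qed (rule X_cong_sym)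
    also have "\<dots> = (\<Sum>p\<in>P. e p t)"
      unfolding sum_distrib_right e_def
      by (intro sum.cong refl) (simp add: power2_eq_square algebra_simps flip: power_int_add)
    finally show ?thesis .
  qed
  have half: "(1 / 2 :: 'a fls) \<in> power_series"
  proof -
    have "fls_const (1 / 2 :: 'a) = 1 / 2"
      using fls_const_divide_const[of 1 "2 :: 'a"] by (simp only: fls_const_1 fls_const_numeral)
    thus ?thesis
      using power_series_fps[of "fps_const (1 / 2 :: 'a)"] by (simp only: fps_const_to_fls)
  qed
  have "theta_sum K * (x ^ w\<^sup>2 * inner_theta w) =
    (\<Sum>t\<in>{- int w..<int w}. 1 / 2 * (theta_sum K * x powi ((int w)\<^sup>2 - t\<^sup>2) + theta_sum K * x powi ((int w)\<^sup>2 - (t + 1)\<^sup>2)))"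
  proof -
    have e: "x powi ((int w)\<^sup>2 - u) = x powi ((int w)\<^sup>2) * x powi (- u)" for u
      by (simp flip: power_int_add)
    have "a * (b * ((c + d) / 2)) = 1 / 2 * (a * (b * c) + a * (b * d))" for a b c d :: "'a fls"
      by (simp add: distrib_left)
    thus ?thesis
      unfolding inner_theta_def sum_distrib_left xw e by (intro sum.cong refl)
  qed
  also have "X_cong K \<dots> (\<Sum>t\<in>{- int w..<int w}. 1 / 2 * ((\<Sum>p\<in>P. e p t) + (\<Sum>p\<in>P. e p (t + 1))))"
    by (intro X_cong_sum X_cong_mult_left half X_cong_add *) auto
  also have "\<dots> = (\<Sum>p\<in>P. \<Sum>t\<in>{- int w..<int w}. (e p t + e p (t + 1)) / 2)"
    by (subst sum.swap) (simp add: sum.distrib flip: sum_divide_distrib)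
  also have "\<dots> = 2 * of_nat w * x ^ w\<^sup>2 +
      (\<Sum>p=1..w + K. (x powi ((int w - int p)\<^sup>2) - x powi ((int w + int p)\<^sup>2)) * coth_series p)"
    unfolding P_def sum_int_symmetric
  proof (intro arg_cong2[where f = "(+)"] sum.cong refl)
    show "(\<Sum>t\<in>{- int w..<int w}. (e 0 t + e 0 (t + 1)) / 2) = 2 * of_nat w * x ^ w\<^sup>2"
      by (simp add: e_def xw)
  next
    fix p assume "p \<in> {1..w + K}"
    hence p: "p > 0" by auto
    have y: "x powi (2 * int p) = x ^ (2 * p)" "x powi (2 * - int p) = inverse (x ^ (2 * p))"
      using power_int_of_nat[of x "2 * p"] by (simp_all add: power_int_minus)
    have nz: "1 - x ^ (2 * p) \<noteq> 0"
      by (rule x_power_nonzero) (use p in auto)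
    have inv: "(1 + inverse (x ^ (2 * p))) / (1 - inverse (x ^ (2 * p))) = - coth_series p"
      unfolding coth_series_def by (rule coth_inverse[OF _ nz]) simp
    have 1: "(\<Sum>t\<in>{- int w..<int w}. (e (int p) t + e (int p) (t + 1)) / 2) =
      (x powi ((int w - int p)\<^sup>2) - x powi ((int w + int p)\<^sup>2)) * coth_series p / 2"
    proof -
      have "int p \<noteq> 0" using p by simp
      from inner_theta_summand[OF this, of w] show ?thesis
        unfolding e_def y coth_series_def .
    qed
    have 2: "(\<Sum>t\<in>{- int w..<int w}. (e (- int p) t + e (- int p) (t + 1)) / 2) =
      (x powi ((int w + int p)\<^sup>2) - x powi ((int w - int p)\<^sup>2)) * (- coth_series p) / 2"
    proof -
      have "- int p \<noteq> 0" using p by simp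
      from inner_theta_summand[OF this, of w] show ?thesis
        unfolding e_def y inv diff_minus_eq_add add_uminus_conv_diff .
    qed
    have "(X - Y) * c / 2 + (Y - X) * (- c) / 2 = (X - Y) * c" for X Y c :: "'a fls"
    proof -
      have *: "(Y - X) * (- c) = (X - Y) * c"
        by (simp add: algebra_simps)
      show ?thesis
        unfolding * by (simp flip: mult_2)
    qed
    thus "(\<Sum>t\<in>{- int w..<int w}. (e (int p) t + e (int p) (t + 1)) / 2) +
      (\<Sum>t\<in>{- int w..<int w}. (e (- int p) t + e (- int p) (t + 1)) / 2) =
      (x powi ((int w - int p)\<^sup>2) - x powi ((int w + int p)\<^sup>2)) * coth_series p"
      unfolding 1 2 .
  qed
  finally show ?thesis .
qed

definition coth_sum :: "nat \<Rightarrow> 'a fls" where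
  "coth_sum n = (\<Sum>w=1..n. coth_series w)"

lemma coth_sum_Suc: "coth_sum (Suc n) = coth_sum n + coth_series (Suc n)"
  by (simp add: coth_sum_def)

lemma coth_series_mult:
  assumes "v > 0" "d > 0"
  shows "coth_series v * coth_series (v + d) = 1 + coth_series d * (coth_series v - coth_series (v + d))"
proof -
  have e: "x ^ (2 * (v + d)) = x ^ (2 * v) * x ^ (2 * d)"
    by (simp add: power_add distrib_left)
  have "1 - x ^ (2 * v) \<noteq> 0" "1 - x ^ (2 * d) \<noteq> 0" "1 - x ^ (2 * (v + d)) \<noteq> 0"
    by (rule x_power_nonzero; use assms in simp)+
  thus ?thesis
    unfolding coth_series_def e by (intro coth_subtraction)
qed

text \<open>By \<open>coth_series_mult\<close> each product is 1 plus \<open>coth_series d\<close>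
  times a difference, so the sum telescopes into values of \<open>coth_sum\<close>.\<close>

lemma sum_coth_series_mult:
  assumes "d > 0"
  shows "(\<Sum>v=1..n. coth_series v * coth_series (v + d)) =
    of_nat n + coth_series d * (coth_sum n + coth_sum d - coth_sum (n + d))"
proof (induction n)
  case (Suc n)
  have "(\<Sum>v=1..Suc n. coth_series v * coth_series (v + d)) =
    (of_nat n + coth_series d * (coth_sum n + coth_sum d - coth_sum (n + d))) +
    (1 + coth_series d * (coth_series (Suc n) - coth_series (Suc n + d)))"
    using Suc coth_series_mult[OF zero_less_Suc assms, of n] by simp
  thus ?case
    by (simp add: coth_sum_Suc algebra_simps)
qed (simp add: coth_sum_def)

text \<open>The addition law with fixed total \<open>m\<close>. The reflection of \<open>w\<close>
  to \<open>m - w\<close> identifies the two resulting sums, and \<open>of_nat m - 1\<close> counts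
  the terms.\<close>

lemma sum_coth_series_mult_complement:
  assumes "m > 0"
  shows "(\<Sum>w=1..m - 1. coth_series w * coth_series (m - w)) =
    2 * coth_series m * coth_sum (m - 1) - (of_nat m - 1)"
proof -
  have *: "coth_series w * coth_series (m - w) = coth_series m * (coth_series w + coth_series (m - w)) - 1"
    if "w \<in> {1..m - 1}" for w
  proof -
    have w: "0 < w" "w < m"
      using that assms by auto
    hence "2 * m = 2 * w + 2 * (m - w)"
      by simp
    hence e: "x ^ (2 * m) = x ^ (2 * w) * x ^ (2 * (m - w))"
      by (rule ssubst) (rule power_add)
    have "1 - x ^ (2 * w) \<noteq> 0" "1 - x ^ (2 * (m - w)) \<noteq> 0" "1 - x ^ (2 * m) \<noteq> 0"
      by (rule x_power_nonzero; use w in simp)+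
    thus ?thesis
      unfolding coth_series_def e by (intro coth_addition)
  qed
  have "(\<Sum>w=1..m - 1. coth_series (m - w)) = coth_sum (m - 1)"
    unfolding coth_sum_def
    by (rule sum.reindex_bij_witness[of _ "\<lambda>w. m - w" "\<lambda>w. m - w"]) (use assms in auto)
  moreover have "(of_nat (m - 1) :: 'a fls) = of_nat m - 1"
    using assms by (simp add: of_nat_diff)
  moreover have "(\<Sum>w=1..m - 1. coth_series w * coth_series (m - w)) =
    (\<Sum>w=1..m - 1. coth_series m * (coth_series w + coth_series (m - w)) - 1)"
    by (rule sum.cong[OF refl *])
  ultimately show ?thesis
    by (simp add: sum_subtractf sum_distrib_left [symmetric] sum.distrib coth_sum_def)
qed

lemma coth_series_cong_1:
  assumes "w > 0"
  shows "X_cong (2 * w) (coth_series w) 1"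
proof -
  have "1 - x ^ (2 * w) \<noteq> 0"
    by (rule x_power_nonzero) (use assms in auto)
  hence "coth_series w = 1 + x ^ (2 * w) * (2 / (1 - x ^ (2 * w)))"
    by (simp add: coth_series_def divide_simps)
  also have "X_cong (2 * w) \<dots> (1 + 0)"
    using assms by (intro X_cong_add X_cong_refl x_power_cong_0 power_series_nome_divide(1)[of x 1] power_series_intros x_power_series)
      (auto simp: x_def)
  finally show ?thesis by simp
qed

text \<open>Every summand beyond index \<open>n\<close> is 1 up to order \<open>2 * Suc n\<close>,
  so differences of \<open>coth_sum\<close> become integers.\<close>

lemma coth_sum_cong:
  assumes "k \<le> 2 * Suc n"
  shows "X_cong k (coth_sum (n + d)) (coth_sum n + of_nat d)"
proof (induction d)
  case (Suc d)
  have "X_cong k (coth_series (Suc (n + d))) 1"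
    using coth_series_cong_1[of "Suc (n + d)"] assms by (auto intro: X_cong_mono)
  from X_cong_add[OF Suc.IH this] show ?case
    by (simp add: coth_sum_Suc ac_simps)
qed simp

text \<open>Subtracting 2 removes the constant term of each summand. The order of what remains grows
  with \<open>w\<close>, so the truncation at \<open>K\<close> approximates an infinite sum.\<close>

definition hecke_sum :: "nat \<Rightarrow> 'a fls" where
  "hecke_sum K = (\<Sum>w=1..K. 2 * x ^ w\<^sup>2 * coth_series w * inner_theta w - 2)"

text \<open>Split by the sign of \<open>w - p\<close>. For \<open>d = w - p > 0\<close> the bound
  \<open>w \<le> K\<close> restricts \<open>v = p\<close> to at most \<open>K - d\<close>; for
  \<open>d = p - w > 0\<close> the index \<open>v = w\<close> runs up to \<open>K\<close>.\<close>

lemma coth_double_sum_diff: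
  "(\<Sum>w=1..K. \<Sum>p=1..w + K. x powi ((int w - int p)\<^sup>2) * (coth_series w * coth_series p)) =
   (\<Sum>w=1..K. (coth_series w)\<^sup>2) +
   (\<Sum>d=1..K. x ^ d\<^sup>2 * (\<Sum>v=1..K - d. coth_series v * coth_series (v + d))) +
   (\<Sum>d=1..K. x ^ d\<^sup>2 * (\<Sum>v=1..K. coth_series v * coth_series (v + d)))"
proof -
  define f where "f w p = x powi ((int w - int p)\<^sup>2) * (coth_series w * coth_series p)" for w p
  have "(\<Sum>p=1..w + K. f w p) = f w w + (\<Sum>p=1..<w. f w p) + (\<Sum>d=1..K. f w (w + d))"
    if "w \<in> {1..K}" for w
  proof -
    have *: "{1..w + K} = insert w ({1..<w} \<union> {w + 1..w + K})"
      using that by auto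
    have "(\<Sum>p=1..w + K. f w p) = f w w + ((\<Sum>p=1..<w. f w p) + (\<Sum>p=w + 1..w + K. f w p))"
      by (subst *, subst sum.insert, simp, simp, subst sum.union_disjoint) auto
    also have "(\<Sum>p=w + 1..w + K. f w p) = (\<Sum>d=1..K. f w (w + d))"
      by (rule sum.reindex_bij_witness[of _ "\<lambda>d. w + d" "\<lambda>p. p - w"]) auto
    finally show ?thesis by (simp add: add.assoc)
  qed
  hence "(\<Sum>w=1..K. \<Sum>p=1..w + K. f w p) =
    (\<Sum>w=1..K. f w w) + (\<Sum>w=1..K. \<Sum>p=1..<w. f w p) + (\<Sum>w=1..K. \<Sum>d=1..K. f w (w + d))"
    by (simp add: sum.distrib)
  also have "(\<Sum>w=1..K. f w w) = (\<Sum>w=1..K. (coth_series w)\<^sup>2)"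
    by (simp add: f_def power2_eq_square)
  also have "(\<Sum>w=1..K. \<Sum>p=1..<w. f w p) = (\<Sum>d=1..K. \<Sum>v=1..K - d. f (v + d) v)"
    unfolding sum.Sigma[OF finite_atLeastAtMost ballI[OF finite_atLeastLessThan]]
      sum.Sigma[OF finite_atLeastAtMost ballI[OF finite_atLeastAtMost]]
    by (rule sum.reindex_bij_witness[of _ "\<lambda>(d, v). (v + d, v)" "\<lambda>(w, p). (w - p, p)"]) auto
  also have "\<dots> = (\<Sum>d=1..K. x ^ d\<^sup>2 * (\<Sum>v=1..K - d. coth_series v * coth_series (v + d)))"
    by (simp add: f_def sum_distrib_left x_powi_nat_square mult.commute)
  also have "(\<Sum>w=1..K. \<Sum>d=1..K. f w (w + d)) =
    (\<Sum>d=1..K. x ^ d\<^sup>2 * (\<Sum>v=1..K. coth_series v * coth_series (v + d)))"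
    by (subst sum.swap) (simp add: f_def sum_distrib_left x_powi_nat_square)
  finally show ?thesis
    unfolding f_def .
qed

text \<open>Terms are grouped by \<open>m = w + p\<close>; those with \<open>m > K\<close> have
  order above \<open>K\<close>.\<close>

lemma coth_double_sum_add:
  "X_cong K (\<Sum>w=1..K. \<Sum>p=1..w + K. x powi ((int w + int p)\<^sup>2) * (coth_series w * coth_series p))
   (\<Sum>m=1..K. x ^ m\<^sup>2 * (\<Sum>w=1..m - 1. coth_series w * coth_series (m - w)))"
proof -
  define f where "f w p = x powi ((int w + int p)\<^sup>2) * (coth_series w * coth_series p)" for w p
  have "X_cong K (\<Sum>p=1..w + K. f w p) (\<Sum>p=1..K - w. f w p)" if "w \<in> {1..K}" for w
  proof -
    have *: "{1..w + K} = {1..K - w} \<union> {K - w + 1..w + K}"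
      using that by auto
    have "(\<Sum>p=1..w + K. f w p) = (\<Sum>p=1..K - w. f w p) + (\<Sum>p=K - w + 1..w + K. f w p)"
      by (subst *, subst sum.union_disjoint) auto
    also have "X_cong K \<dots> ((\<Sum>p=1..K - w. f w p) + (\<Sum>p=K - w + 1..w + K. 0))"
      unfolding f_def using that
      by (intro X_cong_add X_cong_sum X_cong_refl x_powi_square_cong_0 power_series_mult coth_series_power_series) auto
    finally show ?thesis by simp
  qed
  hence "X_cong K (\<Sum>w=1..K. \<Sum>p=1..w + K. f w p) (\<Sum>w=1..K. \<Sum>p=1..K - w. f w p)"
    by (intro X_cong_sum)
  also have "\<dots> = (\<Sum>m=1..K. \<Sum>w=1..m - 1. f w (m - w))"
    unfolding sum.Sigma[OF finite_atLeastAtMost ballI[OF finite_atLeastAtMost]]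
    by (rule sum.reindex_bij_witness[of _ "\<lambda>(m, w). (w, m - w)" "\<lambda>(w, p). (w + p, w)"]) auto
  also have "\<dots> = (\<Sum>m=1..K. x ^ m\<^sup>2 * (\<Sum>w=1..m - 1. coth_series w * coth_series (m - w)))"
  proof (intro sum.cong refl)
    fix m assume "m \<in> {1..K}"
    have "f w (m - w) = x ^ m\<^sup>2 * (coth_series w * coth_series (m - w))" if "w \<in> {1..m - 1}" for w
    proof -
      have "int w + int (m - w) = int m" using that by auto
      thus ?thesis by (simp only: f_def x_powi_nat_square)
    qed
    thus "(\<Sum>w=1..m - 1. f w (m - w)) = x ^ m\<^sup>2 * (\<Sum>w=1..m - 1. coth_series w * coth_series (m - w))"
      by (simp add: sum_distrib_left)
  qed
  finally show ?thesis
    unfolding f_def .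
qed

text \<open>The double sum from \<open>theta_sum_times_inner_theta\<close> separates into
  \<open>A\<close>, grouped by \<open>w - p\<close>, and \<open>B\<close>, grouped by
  \<open>w + p\<close>; in both, the cotangent laws evaluate the inner sums.\<close>

lemma theta_sum_times_hecke_sum:
  "X_cong K (theta_sum K * hecke_sum K)
     (2 * (\<Sum>w=1..K. (coth_series w)\<^sup>2 - 1) + (\<Sum>d=1..K. x ^ d\<^sup>2 * (4 * (coth_series d)\<^sup>2 - 2)))"
proof -
  define g where "g = coth_series"
  have g: "w \<in> {1..n} \<Longrightarrow> g w \<in> power_series" for w n
    unfolding g_def by (intro coth_series_power_series) auto
  define A where "A = (\<Sum>w=1..K. \<Sum>p=1..w + K. x powi ((int w - int p)\<^sup>2) * (g w * g p))"
  define B where "B = (\<Sum>w=1..K. \<Sum>p=1..w + K. x powi ((int w + int p)\<^sup>2) * (g w * g p))"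
  have "theta_sum K * hecke_sum K =
    (\<Sum>w=1..K. 2 * g w * (theta_sum K * (x ^ w\<^sup>2 * inner_theta w)) - 2 * theta_sum K)"
    unfolding hecke_sum_def sum_distrib_left g_def by (intro sum.cong refl) (simp add: algebra_simps)
  also have "X_cong K \<dots> (\<Sum>w=1..K. 2 * g w * (2 * of_nat w * x ^ w\<^sup>2 +
      (\<Sum>p=1..w + K. (x powi ((int w - int p)\<^sup>2) - x powi ((int w + int p)\<^sup>2)) * g p)) - 2 * theta_sum K)"
    unfolding g_def
    by (intro X_cong_sum X_cong_diff X_cong_refl X_cong_mult_left power_series_mult power_series_numeral
        theta_sum_times_inner_theta) (rule coth_series_power_series, simp)
  also have "\<dots> = (\<Sum>w=1..K. 4 * of_nat w * x ^ w\<^sup>2 * g w) + 2 * A - 2 * B - 2 * of_nat K * theta_sum K"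
  proof -
    have "2 * g w * (2 * of_nat w * x ^ w\<^sup>2 +
      (\<Sum>p=1..w + K. (x powi ((int w - int p)\<^sup>2) - x powi ((int w + int p)\<^sup>2)) * g p)) =
      4 * of_nat w * x ^ w\<^sup>2 * g w + 2 * (\<Sum>p=1..w + K. x powi ((int w - int p)\<^sup>2) * (g w * g p))
      - 2 * (\<Sum>p=1..w + K. x powi ((int w + int p)\<^sup>2) * (g w * g p))" for w
    proof -
      have *: "(\<Sum>p=1..w + K. x powi ((int w - int p)\<^sup>2) * (g w * g p)) -
         (\<Sum>p=1..w + K. x powi ((int w + int p)\<^sup>2) * (g w * g p)) =
         g w * (\<Sum>p=1..w + K. (x powi ((int w - int p)\<^sup>2) - x powi ((int w + int p)\<^sup>2)) * g p)"
        unfolding sum_distrib_left sum_subtractf [symmetric] by (intro sum.cong refl) (simp add: algebra_simps)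
      have "2 * u * (2 * n * y + s) = 4 * n * y * u + 2 * a - 2 * b" if "a - b = u * s" for u n y s a b :: "'a fls"
      proof -
        have "2 * u * (2 * n * y + s) = 4 * n * y * u + 2 * (u * s)"
          by (simp add: algebra_simps)
        thus ?thesis
          unfolding that [symmetric] by (simp add: algebra_simps)
      qed
      from this[OF *] show ?thesis .
    qed
    thus ?thesis
      by (simp add: sum.distrib sum_subtractf sum_distrib_left A_def B_def)
  qed
  also have "X_cong K \<dots> ((\<Sum>w=1..K. 4 * of_nat w * x ^ w\<^sup>2 * g w) +
      2 * ((\<Sum>w=1..K. (g w)\<^sup>2) + (\<Sum>d=1..K. x ^ d\<^sup>2 * (of_nat (K - d) + g d * (coth_sum d - of_nat d)))
        + (\<Sum>d=1..K. x ^ d\<^sup>2 * (of_nat K + g d * (coth_sum d - of_nat d))))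
      - 2 * (\<Sum>d=1..K. x ^ d\<^sup>2 * (2 * g d * coth_sum (d - 1) - (of_nat d - 1)))
      - 2 * of_nat K * theta_sum K)"
  proof (intro X_cong_add X_cong_diff X_cong_refl X_cong_mult_left power_series_numeral)
    have 1: "X_cong K (\<Sum>d=1..K. x ^ d\<^sup>2 * (\<Sum>v=1..K - d. g v * g (v + d)))
      (\<Sum>d=1..K. x ^ d\<^sup>2 * (of_nat (K - d) + g d * (coth_sum d - of_nat d)))"
    proof (intro X_cong_sum)
      fix d assume d: "d \<in> {1..K}"
      have "(\<Sum>v=1..K - d. g v * g (v + d)) = of_nat (K - d) + g d * (coth_sum (K - d) + coth_sum d - coth_sum (K - d + d))"
        unfolding g_def by (rule sum_coth_series_mult) (use d in auto)
      also have "X_cong (2 * Suc (K - d)) \<dots> (of_nat (K - d) + g d * (coth_sum (K - d) + coth_sum d - (coth_sum (K - d) + of_nat d)))"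
        using d by (intro X_cong_add X_cong_diff X_cong_refl X_cong_mult_left coth_sum_cong g) auto
      finally have "X_cong (2 * Suc (K - d)) (\<Sum>v=1..K - d. g v * g (v + d)) (of_nat (K - d) + g d * (coth_sum d - of_nat d))"
        by simp
      \<comment> \<open>Stopping the inner sum at \<open>K - d\<close> leaves precision
        \<open>2 * Suc (K - d)\<close> only; the square power of \<open>x\<close> in front makes up
        for the loss, as \<open>2 d \<le> d^2 + 1\<close>.\<close>
      moreover have "K \<le> d\<^sup>2 + 2 * Suc (K - d)"
      proof -
        have "2 * d \<le> d * d + 1"
          by (cases d) auto
        thus ?thesis
          using d by (auto simp: power2_eq_square)
      qed
      ultimately show "X_cong K (x ^ d\<^sup>2 * (\<Sum>v=1..K - d. g v * g (v + d)))
          (x ^ d\<^sup>2 * (of_nat (K - d) + g d * (coth_sum d - of_nat d)))"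
        unfolding x_def by (rule X_cong_X_power_mult)
    qed
    have 2: "X_cong K (\<Sum>d=1..K. x ^ d\<^sup>2 * (\<Sum>v=1..K. g v * g (v + d)))
      (\<Sum>d=1..K. x ^ d\<^sup>2 * (of_nat K + g d * (coth_sum d - of_nat d)))"
    proof (intro X_cong_sum X_cong_mult_left power_series_power x_power_series)
      fix d assume d: "d \<in> {1..K}"
      have "(\<Sum>v=1..K. g v * g (v + d)) = of_nat K + g d * (coth_sum K + coth_sum d - coth_sum (K + d))"
        unfolding g_def by (rule sum_coth_series_mult) (use d in auto)
      also have "X_cong K \<dots> (of_nat K + g d * (coth_sum K + coth_sum d - (coth_sum K + of_nat d)))"
        using d by (intro X_cong_add X_cong_diff X_cong_refl X_cong_mult_left coth_sum_cong g) auto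
      finally show "X_cong K (\<Sum>v=1..K. g v * g (v + d)) (of_nat K + g d * (coth_sum d - of_nat d))"
        by simp
    qed
    show "X_cong K A ((\<Sum>w=1..K. (g w)\<^sup>2) + (\<Sum>d=1..K. x ^ d\<^sup>2 * (of_nat (K - d) + g d * (coth_sum d - of_nat d)))
        + (\<Sum>d=1..K. x ^ d\<^sup>2 * (of_nat K + g d * (coth_sum d - of_nat d))))"
      using X_cong_add[OF X_cong_add[OF X_cong_refl 1] 2]
      unfolding A_def g_def coth_double_sum_diff .
    have "X_cong K B (\<Sum>m=1..K. x ^ m\<^sup>2 * (\<Sum>w=1..m - 1. g w * g (m - w)))"
      unfolding B_def g_def by (rule coth_double_sum_add)
    also have "\<dots> = (\<Sum>d=1..K. x ^ d\<^sup>2 * (2 * g d * coth_sum (d - 1) - (of_nat d - 1)))"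
      unfolding g_def by (intro sum.cong refl, subst sum_coth_series_mult_complement) auto
    finally show "X_cong K B \<dots>" .
  qed
  also have "\<dots> = 2 * (\<Sum>w=1..K. (g w)\<^sup>2 - 1) + (\<Sum>d=1..K. x ^ d\<^sup>2 * (4 * (g d)\<^sup>2 - 2))"
  proof -
    \<comment> \<open>With \<open>coth_sum d = coth_sum (d - 1) + g d\<close>, all values of
      \<open>coth_sum\<close> and all multiples of \<open>K\<close> and \<open>d\<close>
      cancel.\<close>
    have *: "4 * of_nat d * x ^ d\<^sup>2 * g d
      + 2 * (x ^ d\<^sup>2 * (of_nat (K - d) + g d * (coth_sum d - of_nat d)))
      + 2 * (x ^ d\<^sup>2 * (of_nat K + g d * (coth_sum d - of_nat d)))
      - 2 * (x ^ d\<^sup>2 * (2 * g d * coth_sum (d - 1) - (of_nat d - 1)))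
      - 4 * of_nat K * x ^ d\<^sup>2 = x ^ d\<^sup>2 * (4 * (g d)\<^sup>2 - 2)" if "d \<in> {1..K}" for d
    proof -
      have c: "coth_sum d = coth_sum (d - 1) + g d"
        using that coth_sum_Suc[of "d - 1"] by (simp add: g_def)
      have k: "(of_nat (K - d) :: 'a fls) = of_nat K - of_nat d"
        using that by (simp add: of_nat_diff)
      show ?thesis
        unfolding c k by (simp add: algebra_simps power2_eq_square)
    qed
    have "(\<Sum>d=1..K. 4 * of_nat d * x ^ d\<^sup>2 * g d)
      + 2 * (\<Sum>d=1..K. x ^ d\<^sup>2 * (of_nat (K - d) + g d * (coth_sum d - of_nat d)))
      + 2 * (\<Sum>d=1..K. x ^ d\<^sup>2 * (of_nat K + g d * (coth_sum d - of_nat d)))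
      - 2 * (\<Sum>d=1..K. x ^ d\<^sup>2 * (2 * g d * coth_sum (d - 1) - (of_nat d - 1)))
      - 4 * of_nat K * (\<Sum>d=1..K. x ^ d\<^sup>2) = (\<Sum>d=1..K. x ^ d\<^sup>2 * (4 * (g d)\<^sup>2 - 2))"
      unfolding sum_distrib_left sum.distrib [symmetric] sum_subtractf [symmetric]
      by (rule sum.cong[OF refl *])
    thus ?thesis
      unfolding theta_sum_eq sum_subtractf by (simp add: algebra_simps)
  qed
  finally show ?thesis
    unfolding g_def .
qed

end

section \<open>The signed generating function as a Hecke-type sum\<close>

text \<open>Over the denominator \<open>(1 - z^2)^2\<close> the numerator collapses to
  \<open>8 z (1 - z)^2\<close>. With \<open>z = q ^ d\<close> this merges the contributions of
  theta, the squared cotangent and MacMahon's identity into the Appell summand.\<close>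

lemma coth_appell_identity:
  fixes z :: "'a::field"
  assumes "1 + z \<noteq> 0" "1 - z\<^sup>2 \<noteq> 0"
  shows "4 - 4 * ((1 + z\<^sup>2) / (1 - z\<^sup>2))\<^sup>2 + 8 * (z * (1 + z\<^sup>2) / (1 - z\<^sup>2)\<^sup>2) = 8 * (z / (1 + z)\<^sup>2)"
proof -
  define D where "D = (1 - z\<^sup>2)\<^sup>2"
  have D: "D \<noteq> 0"
    using assms by (simp add: D_def)
  have "4 - 4 * ((1 + z\<^sup>2) / (1 - z\<^sup>2))\<^sup>2 + 8 * (z * (1 + z\<^sup>2) / (1 - z\<^sup>2)\<^sup>2) =
    (4 * D - 4 * (1 + z\<^sup>2)\<^sup>2 + 8 * (z * (1 + z\<^sup>2))) / D"
  proof -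
    have "4 - 4 * (a / D) + 8 * (b / D) = (4 * D - 4 * a + 8 * b) / D" for a b
      using D by (simp add: add_divide_distrib diff_divide_distrib)
    thus ?thesis
      unfolding power_divide D_def .
  qed
  also have "4 * D - 4 * (1 + z\<^sup>2)\<^sup>2 + 8 * (z * (1 + z\<^sup>2)) = 8 * (z * (1 - z)\<^sup>2)"
    by (simp add: D_def power2_eq_square algebra_simps)
  also have "D = (1 + z)\<^sup>2 * (1 - z)\<^sup>2"
    by (simp add: D_def power2_eq_square algebra_simps)
  also have "8 * (z * (1 - z)\<^sup>2) / ((1 + z)\<^sup>2 * (1 - z)\<^sup>2) = 8 * (z / (1 + z)\<^sup>2)"
    using D \<open>D = (1 + z)\<^sup>2 * (1 - z)\<^sup>2\<close> by simp
  finally show ?thesis .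
qed

section \<open>The substitution \<open>q = - x\<close>\<close>

context
  fixes x q :: "'a::field_char_0 fls"
  defines "x \<equiv> fls_X" and "q \<equiv> - x"
begin

lemma q_nome: "q = fls_X * - 1" "- 1 \<in> power_series"
  by (simp_all add: q_def x_def power_series_1 power_series_minus)

lemma q2_nome: "q\<^sup>2 = fls_X * fls_X" "fls_X \<in> power_series"
  by (simp_all add: q_def x_def power2_eq_square power_series_X)

lemma x_square_eq: "x ^ d\<^sup>2 = (- 1) ^ d * q ^ d\<^sup>2"
  by (simp add: q_def power_minus[of x "d\<^sup>2"] flip: power_add)

lemma x_power_double: "x ^ (2 * d) = (q ^ d)\<^sup>2"
proof -
  have "x ^ (2 * d) = (q\<^sup>2) ^ d"
    by (simp add: q_def power_mult)
  thus ?thesis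
    by (simp add: power_mult [symmetric] mult.commute)
qed

text \<open>The ratio is 1 only up to order \<open>K + 1 - r\<close>; the prefactor
  \<open>x ^ n\<close> supplies the rest. For \<open>n = r^2\<close> this is
  \<open>less_square_add\<close>.\<close>

lemma central_ratio_X_cong:
  assumes "q' = fls_X * u" "u \<in> power_series" "r \<in> {1..K}" "f \<in> power_series" "K < n + (K + 1 - r) + 1"
  shows "X_cong K (x ^ n * f * central_ratio q' K r) (x ^ n * f)"
proof -
  have "X_cong (Suc K - r) (central_ratio q' K r) 1"
    using central_ratio_cong_1[OF assms(1,2), of r K] assms(3) by simp
  hence "X_cong (Suc K - r) (f * central_ratio q' K r) (f * 1)"
    by (rule X_cong_mult_left[OF assms(4)])
  hence "X_cong K (x ^ n * (f * central_ratio q' K r)) (x ^ n * (f * 1))"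
    unfolding x_def by (rule X_cong_X_power_mult) (use assms(3,5) in auto)
  thus ?thesis
    by (simp add: mult.assoc)
qed

lemma less_square_add: "K < r\<^sup>2 + (K + 1 - r) + 1" if "r \<in> {1..K}" for r K :: nat
proof -
  have "r \<le> r\<^sup>2"
    by (simp add: power2_eq_square)
  thus ?thesis using that by auto
qed

lemma theta_ratio_cong_theta_sum: "X_cong K (theta_ratio q K) (theta_sum K)"
proof -
  have "theta_ratio q K = 1 + 2 * (\<Sum>r=1..K. (-1) ^ r * q ^ r\<^sup>2 * central_ratio q K r)"
    by (rule finite_theta [symmetric]; rule nome_nonzero[OF q_nome])
  also have "\<dots> = 1 + 2 * (\<Sum>r=1..K. x ^ r\<^sup>2 * 1 * central_ratio q K r)"
    by (simp add: x_square_eq)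
  also have "X_cong K \<dots> (1 + 2 * (\<Sum>r=1..K. x ^ r\<^sup>2 * 1))"
    by (intro X_cong_add X_cong_refl X_cong_mult_left X_cong_sum power_series_numeral
        central_ratio_X_cong[OF q_nome] power_series_1 less_square_add)
  finally show ?thesis
    by (simp add: theta_sum_eq x_def)
qed

lemma appell_sum_cong:
  "X_cong K (appell_sum q K) (1 + 8 * (\<Sum>d=1..K. x ^ d\<^sup>2 * (q ^ d / (1 + q ^ d)\<^sup>2)))"
proof -
  have "appell_sum q K = 1 + 8 * (\<Sum>d=1..K. x ^ d\<^sup>2 * (q ^ d / (1 + q ^ d)\<^sup>2) * central_ratio q K d)"
    by (simp add: appell_sum_def x_square_eq power_add mult.assoc)
  also have "X_cong K \<dots> (1 + 8 * (\<Sum>d=1..K. x ^ d\<^sup>2 * (q ^ d / (1 + q ^ d)\<^sup>2)))"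
    by (intro X_cong_add X_cong_refl X_cong_mult_left X_cong_sum power_series_numeral
        central_ratio_X_cong[OF q_nome] less_square_add power_series_nome_divide[OF q_nome]
        power_series_power nome_power_series[OF q_nome]) auto
  finally show ?thesis .
qed

text \<open>This is \<open>finite_macmahon\<close> at \<open>q^2\<close>: doubling the triangular
  exponent gives \<open>d^2 + d\<close>, and the sign turns the \<open>q\<close>-power with exponent
  \<open>d^2\<close> into a power of \<open>x\<close>.\<close>

lemma macmahon_cong:
  "X_cong K (\<Sum>w=1..K. (q ^ w)\<^sup>2 / (1 - (q ^ w)\<^sup>2)\<^sup>2)
     (- (\<Sum>d=1..K. x ^ d\<^sup>2 * (q ^ d * (1 + (q ^ d)\<^sup>2) / (1 - (q ^ d)\<^sup>2)\<^sup>2)))"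
proof -
  have pow: "(q\<^sup>2) ^ d = (q ^ d)\<^sup>2" for d
    by (simp add: power_mult [symmetric] mult.commute)
  have "(\<Sum>w=1..K. (q ^ w)\<^sup>2 / (1 - (q ^ w)\<^sup>2)\<^sup>2) =
    (\<Sum>d=1..K. (-1) ^ Suc d * (q\<^sup>2) ^ (d * (d + 1) div 2) * (1 + (q ^ d)\<^sup>2) / (1 - (q ^ d)\<^sup>2)\<^sup>2 * central_ratio (q\<^sup>2) K d)"
    unfolding pow [symmetric] by (rule finite_macmahon [symmetric]; rule nome_nonzero[OF q2_nome])
  also have "\<dots> = - (\<Sum>d=1..K. x ^ d\<^sup>2 * (q ^ d * (1 + (q ^ d)\<^sup>2) / (1 - (q ^ d)\<^sup>2)\<^sup>2) * central_ratio (q\<^sup>2) K d)"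
    unfolding sum_negf [symmetric]
  proof (intro sum.cong refl)
    fix d :: nat
    have "2 * (d * (d + 1) div 2) = d\<^sup>2 + d"
      by (simp add: power2_eq_square)
    hence "(-1) ^ Suc d * (q\<^sup>2) ^ (d * (d + 1) div 2) = - (x ^ d\<^sup>2 * q ^ d)"
      by (simp only: power_mult [symmetric] x_square_eq power_add) simp
    thus "(-1) ^ Suc d * (q\<^sup>2) ^ (d * (d + 1) div 2) * (1 + (q ^ d)\<^sup>2) / (1 - (q ^ d)\<^sup>2)\<^sup>2 * central_ratio (q\<^sup>2) K d =
      - (x ^ d\<^sup>2 * (q ^ d * (1 + (q ^ d)\<^sup>2) / (1 - (q ^ d)\<^sup>2)\<^sup>2) * central_ratio (q\<^sup>2) K d)"
      by (simp only:) (simp add: mult.assoc)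
  qed
  also have "X_cong K \<dots> (- (\<Sum>d=1..K. x ^ d\<^sup>2 * (q ^ d * (1 + (q ^ d)\<^sup>2) / (1 - (q ^ d)\<^sup>2)\<^sup>2)))"
  proof (intro X_cong_minus X_cong_sum central_ratio_X_cong[OF q2_nome] less_square_add)
    fix d assume "d \<in> {1..K}"
    thus "q ^ d * (1 + (q ^ d)\<^sup>2) / (1 - (q ^ d)\<^sup>2)\<^sup>2 \<in> power_series"
      unfolding pow [symmetric]
      by (intro power_series_nome_divide(3)[OF q2_nome] power_series_mult power_series_add power_series_1
          power_series_power nome_power_series[OF q_nome]) auto
  qed
  finally show ?thesis .
qed

text \<open>In \<open>theta_sum_times_hecke_sum\<close> the part with
  \<open>(coth_series w)^2 - 1\<close> carries no square exponents; \<open>macmahon_cong\<close>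
  rewrites it in that form. Then \<open>coth_appell_identity\<close> applies term by term.\<close>

lemma appell_sum_cong_hecke_sum:
  "X_cong K (appell_sum q K) (theta_sum K * (1 - hecke_sum K))"
proof -
  define z where "z d = q ^ d" for d
  have g: "coth_series d = (1 + (z d)\<^sup>2) / (1 - (z d)\<^sup>2)" for d
    using x_power_double[of d] by (simp add: coth_series_def x_def z_def)
  have nz: "1 + z d \<noteq> 0" "1 - (z d)\<^sup>2 \<noteq> 0" if "d > 0" for d
  proof -
    show "1 + z d \<noteq> 0"
      unfolding z_def by (rule nome_nonzero[OF q_nome that])
    have "1 - (q\<^sup>2) ^ d \<noteq> 0"
      by (rule nome_nonzero[OF q2_nome that])
    thus "1 - (z d)\<^sup>2 \<noteq> 0"
      by (simp add: z_def power_mult [symmetric] mult.commute)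
  qed
  have "X_cong K (theta_sum K * hecke_sum K)
     (2 * (\<Sum>w=1..K. (coth_series w)\<^sup>2 - 1) + (\<Sum>d=1..K. x ^ d\<^sup>2 * (4 * (coth_series d)\<^sup>2 - 2)))"
    unfolding x_def by (rule theta_sum_times_hecke_sum)
  also have "2 * (\<Sum>w=1..K. (coth_series w)\<^sup>2 - 1) = 8 * (\<Sum>w=1..K. (z w)\<^sup>2 / (1 - (z w)\<^sup>2)\<^sup>2)"
    unfolding sum_distrib_left
  proof (intro sum.cong refl)
    fix w assume "w \<in> {1..K}"
    hence "1 - (z w)\<^sup>2 \<noteq> 0" by (intro nz) auto
    moreover have "2 * (((1 + y) / (1 - y))\<^sup>2 - 1) = 8 * (y / (1 - y)\<^sup>2)" if "1 - y \<noteq> 0" for y :: "'a fls"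
    proof -
      have "((1 + y) / (1 - y))\<^sup>2 - 1 = ((1 + y)\<^sup>2 - (1 - y)\<^sup>2) / (1 - y)\<^sup>2"
        using that by (simp add: power_divide diff_divide_distrib)
      also have "(1 + y)\<^sup>2 - (1 - y)\<^sup>2 = 4 * y"
        by (simp add: power2_eq_square algebra_simps)
      finally show ?thesis by simp
    qed
    ultimately show "2 * ((coth_series w)\<^sup>2 - 1) = 8 * ((z w)\<^sup>2 / (1 - (z w)\<^sup>2)\<^sup>2)"
      unfolding g by blast
  qed
  also have "X_cong K (\<dots> + (\<Sum>d=1..K. x ^ d\<^sup>2 * (4 * (coth_series d)\<^sup>2 - 2)))
    (8 * (- (\<Sum>d=1..K. x ^ d\<^sup>2 * (z d * (1 + (z d)\<^sup>2) / (1 - (z d)\<^sup>2)\<^sup>2)))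
     + (\<Sum>d=1..K. x ^ d\<^sup>2 * (4 * (coth_series d)\<^sup>2 - 2)))"
    unfolding z_def by (intro X_cong_add X_cong_refl X_cong_mult_left power_series_numeral macmahon_cong)
  finally have "X_cong K (theta_sum K - theta_sum K * hecke_sum K) (theta_sum K - \<dots>)"
    by (intro X_cong_diff X_cong_refl)
  also have "theta_sum K - (8 * (- (\<Sum>d=1..K. x ^ d\<^sup>2 * (z d * (1 + (z d)\<^sup>2) / (1 - (z d)\<^sup>2)\<^sup>2)))
     + (\<Sum>d=1..K. x ^ d\<^sup>2 * (4 * (coth_series d)\<^sup>2 - 2))) =
     1 + (\<Sum>d=1..K. x ^ d\<^sup>2 * (4 - 4 * (coth_series d)\<^sup>2 + 8 * (z d * (1 + (z d)\<^sup>2) / (1 - (z d)\<^sup>2)\<^sup>2)))"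
  proof -
    have "x ^ d\<^sup>2 * (4 - 4 * c + 8 * u) = 2 * x ^ d\<^sup>2 + 8 * (x ^ d\<^sup>2 * u) - x ^ d\<^sup>2 * (4 * c - 2)" for d c u
      by (simp add: algebra_simps)
    hence "(\<Sum>d=1..K. x ^ d\<^sup>2 * (4 - 4 * (coth_series d)\<^sup>2 + 8 * (z d * (1 + (z d)\<^sup>2) / (1 - (z d)\<^sup>2)\<^sup>2))) =
       2 * (\<Sum>d=1..K. x ^ d\<^sup>2) + 8 * (\<Sum>d=1..K. x ^ d\<^sup>2 * (z d * (1 + (z d)\<^sup>2) / (1 - (z d)\<^sup>2)\<^sup>2))
       - (\<Sum>d=1..K. x ^ d\<^sup>2 * (4 * (coth_series d)\<^sup>2 - 2))"
      by (simp only: sum.distrib sum_subtractf sum_distrib_left)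
    thus ?thesis
      unfolding theta_sum_eq x_def [symmetric] by simp
  qed
  also have "(\<Sum>d=1..K. x ^ d\<^sup>2 * (4 - 4 * (coth_series d)\<^sup>2 + 8 * (z d * (1 + (z d)\<^sup>2) / (1 - (z d)\<^sup>2)\<^sup>2))) =
    (\<Sum>d=1..K. x ^ d\<^sup>2 * (8 * (z d / (1 + z d)\<^sup>2)))"
  proof (intro sum.cong refl arg_cong2[where f = "(*)"])
    fix d assume "d \<in> {1..K}"
    hence "d > 0" by simp
    from coth_appell_identity[OF nz[OF this]]
    show "4 - 4 * (coth_series d)\<^sup>2 + 8 * (z d * (1 + (z d)\<^sup>2) / (1 - (z d)\<^sup>2)\<^sup>2) = 8 * (z d / (1 + z d)\<^sup>2)"
      unfolding g .
  qed
  also have "\<dots> = 8 * (\<Sum>d=1..K. x ^ d\<^sup>2 * (q ^ d / (1 + q ^ d)\<^sup>2))"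
    by (simp add: sum_distrib_left z_def mult.left_commute)
  finally have "X_cong K (theta_sum K * (1 - hecke_sum K)) (1 + 8 * (\<Sum>d=1..K. x ^ d\<^sup>2 * (q ^ d / (1 + q ^ d)\<^sup>2)))"
    by (simp add: right_diff_distrib)
  thus ?thesis
    using appell_sum_cong X_cong_sym X_cong_trans by blast
qed

lemma x_power_times_inner_theta:
  assumes "w > 0"
  shows "x ^ w\<^sup>2 * inner_theta w = 1 + (\<Sum>t\<in>{- int w<..<int w}. x powi ((int w)\<^sup>2 - t\<^sup>2))"
proof -
  have x: "x \<noteq> 0" by (simp add: x_def)
  have xw: "x ^ w\<^sup>2 = x powi ((int w)\<^sup>2)"
    by (simp flip: of_nat_power)
  define f where "f t = x powi ((int w)\<^sup>2 - t\<^sup>2)" for t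
  have f: "x powi ((int w)\<^sup>2) * x powi (- t\<^sup>2) = f t" for t
    using x by (simp add: f_def flip: power_int_add)
  have "x ^ w\<^sup>2 * inner_theta w = (\<Sum>t\<in>{- int w..<int w}. (f t + f (t + 1)) / 2)"
    unfolding inner_theta_def x_def [symmetric] xw sum_distrib_left times_divide_eq_right distrib_left f ..
  also have "\<dots> = ((\<Sum>t\<in>{- int w..<int w}. f t) + (\<Sum>t\<in>{- int w..<int w}. f (t + 1))) / 2"
    by (simp add: sum.distrib flip: sum_divide_distrib)
  also have "{- int w..<int w} = insert (- int w) {- int w<..<int w}"
    using assms by auto
  also have "(\<Sum>t\<in>insert (- int w) {- int w<..<int w}. f (t + 1)) = (\<Sum>t\<in>insert (int w) {- int w<..<int w}. f t)"
    by (rule sum.reindex_bij_witness[of _ "\<lambda>t. t - 1" "\<lambda>t. t + 1"]) (use assms in auto)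
  also have "(\<Sum>t\<in>insert (- int w) {- int w<..<int w}. f t) = 1 + (\<Sum>t\<in>{- int w<..<int w}. f t)"
    by (simp add: f_def)
  also have "(\<Sum>t\<in>insert (int w) {- int w<..<int w}. f t) = 1 + (\<Sum>t\<in>{- int w<..<int w}. f t)"
    by (simp add: f_def)
  also have "(u + u) / 2 = u" for u :: "'a fls"
    by (simp flip: mult_2)
  finally show ?thesis
    unfolding f_def .
qed

text \<open>The form in which positivity is visible: the two half-weighted ends of
  \<open>inner_theta\<close> contribute the 1 in \<open>x_power_times_inner_theta\<close>, and
  \<open>2 * coth_series w - 2\<close> becomes a Lambert term.\<close>

lemma hecke_sum_eq:
  "hecke_sum K = (\<Sum>w=1..K. 4 * (x ^ (2 * w) / (1 - x ^ (2 * w))) +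
     2 * coth_series w * (\<Sum>t\<in>{- int w<..<int w}. x powi ((int w)\<^sup>2 - t\<^sup>2)))"
  unfolding hecke_sum_def x_def [symmetric]
proof (intro sum.cong refl)
  fix w assume "w \<in> {1..K}"
  hence w: "w > 0" by simp
  have "1 - x ^ (2 * w) \<noteq> 0"
    unfolding x_def by (rule x_power_nonzero) (use w in simp)
  hence g: "2 * coth_series w = 2 + 4 * (x ^ (2 * w) / (1 - x ^ (2 * w)))"
    by (simp add: coth_series_def x_def divide_simps)
  have "2 * x ^ w\<^sup>2 * coth_series w * inner_theta w - 2 =
      2 * coth_series w * (x ^ w\<^sup>2 * inner_theta w) - 2"
    by simp
  also have "\<dots> = 2 * coth_series w - 2 + 2 * coth_series w * (\<Sum>t\<in>{- int w<..<int w}. x powi ((int w)\<^sup>2 - t\<^sup>2))"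
    unfolding x_power_times_inner_theta[OF w] by (simp add: distrib_left)
  also have "2 * coth_series w - 2 = 4 * (x ^ (2 * w) / (1 - x ^ (2 * w)))"
    by (simp add: g)
  finally show "2 * x ^ w\<^sup>2 * coth_series w * inner_theta w - 2 = 4 * (x ^ (2 * w) / (1 - x ^ (2 * w))) +
     2 * coth_series w * (\<Sum>t\<in>{- int w<..<int w}. x powi ((int w)\<^sup>2 - t\<^sup>2))" .
qed

lemma square_diff_nonneg: "0 \<le> (int w)\<^sup>2 - t\<^sup>2" if "t \<in> {- int w<..<int w}"
proof -
  have "\<bar>t\<bar> \<le> \<bar>int w\<bar>" using that by auto
  hence "t\<^sup>2 \<le> (int w)\<^sup>2" by (simp only: abs_le_square_iff)
  thus ?thesis by simp
qed

lemma hecke_sum_power_series: "(hecke_sum K :: 'a fls) \<in> power_series"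
proof -
  have 1: "x powi ((int w)\<^sup>2 - t\<^sup>2) \<in> power_series" if "t \<in> {- int w<..<int w}" for w t
    unfolding x_def by (intro power_series_X_powi square_diff_nonneg that)
  have 2: "x ^ (2 * w) / (1 - x ^ (2 * w)) \<in> power_series" if "w \<in> {1..K}" for w
    unfolding x_def using that
    by (intro power_series_nome_divide(1)[of fls_X 1] power_series_power power_series_X power_series_1) auto
  show ?thesis
    unfolding hecke_sum_eq
    by (intro power_series_sum power_series_add power_series_mult power_series_numeral
        coth_series_power_series 1 2) auto
qed

text \<open>Times the unit \<open>R = theta_ratio q K\<close>, both sides are congruent to the
  Appell-type sum, the right one because \<open>R\<close> agrees with \<open>theta_sum K\<close>
  modulo \<open>x ^ K\<close>; then \<open>R\<close> is cancelled.\<close>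

lemma alternating_theta_ratio_cong_hecke_sum:
  "X_cong K (1 + (\<Sum>m=1..K. (-1) ^ m * (theta_ratio q m - theta_ratio q (m - 1)))) (1 - hecke_sum K)"
proof -
  define R where "R = theta_ratio q K"
  define G where "G = R * (1 + 4 * (\<Sum>j=1..K. q ^ j / ((1 + q ^ j)\<^sup>2 * theta_ratio q j)))"
  have R: "R \<noteq> 0" "inverse R \<in> power_series"
    unfolding R_def
    by (rule X_cong_1_unit[OF theta_ratio_power_series[OF q_nome] theta_ratio_cong_1[OF q_nome]])+
  have "R * G = appell_sum q K"
    unfolding G_def R_def mult.assoc [symmetric] power2_eq_square [symmetric]
    by (rule appell_sum_eq [symmetric]; rule nome_nonzero[OF q_nome])
  also have "X_cong K \<dots> (theta_sum K * (1 - hecke_sum K))"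
    by (rule appell_sum_cong_hecke_sum)
  also have "X_cong K \<dots> (R * (1 - hecke_sum K))"
    unfolding R_def
    by (intro X_cong_mult_right power_series_diff power_series_1 hecke_sum_power_series
        X_cong_sym[OF theta_ratio_cong_theta_sum])
  finally have "X_cong K (inverse R * (R * G)) (inverse R * (R * (1 - hecke_sum K)))"
    by (rule X_cong_mult_left[OF R(2)])
  hence "X_cong K G (1 - hecke_sum K)"
    using R(1) by (simp add: mult.assoc [symmetric])
  moreover have "X_cong K (1 + (\<Sum>m=1..K. (-1) ^ m * (theta_ratio q m - theta_ratio q (m - 1)))) G"
    unfolding G_def R_def by (rule alternating_theta_ratio_cong[OF q_nome])
  ultimately show ?thesis
    using X_cong_trans by blast
qed

end

section \<open>Positivity of the coefficients\<close>

definition nonneg_series :: "'a::linordered_field fls set" where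
  "nonneg_series = fps_to_fls ` {h. \<forall>n. fps_nth h n \<ge> 0}"

lemma nonneg_seriesI: "(\<And>n. fps_nth h n \<ge> 0) \<Longrightarrow> fps_to_fls h \<in> nonneg_series"
  by (auto simp: nonneg_series_def)

lemma nonneg_series_nth: "f \<in> nonneg_series \<Longrightarrow> fls_nth f n \<ge> 0"
  by (auto simp: nonneg_series_def)

lemma nonneg_series_0: "0 \<in> nonneg_series"
  using nonneg_seriesI[of 0] by simp

lemma nonneg_series_1: "1 \<in> nonneg_series"
proof -
  have "fps_to_fls 1 \<in> nonneg_series"
    by (rule nonneg_seriesI) simp
  thus ?thesis by simp
qed

lemma nonneg_series_X: "fls_X \<in> nonneg_series"
proof -
  have "fps_to_fls fps_X \<in> nonneg_series"
    by (rule nonneg_seriesI) simp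
  thus ?thesis by simp
qed

lemma nonneg_series_add: "f \<in> nonneg_series \<Longrightarrow> g \<in> nonneg_series \<Longrightarrow> f + g \<in> nonneg_series"
  by (auto simp: nonneg_series_def simp flip: fps_to_fls_plus)

lemma nonneg_series_mult:
  assumes "f \<in> nonneg_series" "g \<in> nonneg_series"
  shows "f * g \<in> nonneg_series"
proof -
  obtain h k where h: "f = fps_to_fls h" "\<And>n. fps_nth h n \<ge> 0"
    and k: "g = fps_to_fls k" "\<And>n. fps_nth k n \<ge> 0"
    using assms by (auto simp: nonneg_series_def)
  have "fps_to_fls (h * k) \<in> nonneg_series"
    using h(2) k(2) by (intro nonneg_seriesI) (auto simp: fps_mult_nth intro!: sum_nonneg mult_nonneg_nonneg)
  thus ?thesis
    by (simp add: h(1) k(1) fls_times_fps_to_fls)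
qed

lemma nonneg_series_numeral: "numeral n \<in> nonneg_series"
proof -
  have "fps_to_fls (numeral n) \<in> nonneg_series"
    by (rule nonneg_seriesI) (simp add: fps_numeral_nth)
  thus ?thesis by simp
qed

lemma nonneg_series_power: "f \<in> nonneg_series \<Longrightarrow> f ^ n \<in> nonneg_series"
  by (induction n) (auto intro: nonneg_series_1 nonneg_series_mult)

lemma nonneg_series_sum: "(\<And>i. i \<in> A \<Longrightarrow> f i \<in> nonneg_series) \<Longrightarrow> sum f A \<in> nonneg_series"
  by (induction A rule: infinite_finite_induct) (auto intro: nonneg_series_0 nonneg_series_add)

lemma nonneg_series_geometric:
  assumes "k > 0"
  shows "1 / (1 - fls_X ^ k) \<in> nonneg_series"
proof -
  define h :: "'a fps" where "h = Abs_fps (\<lambda>n. if k dvd n then 1 else 0)"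
  have "h = 1 + fps_X ^ k * h"
  proof (rule fps_ext)
    fix n show "fps_nth h n = fps_nth (1 + fps_X ^ k * h) n"
      using assms by (auto simp: h_def fps_X_power_mult_nth dvd_minus_self dest: dvd_imp_le)
  qed
  hence "fps_to_fls h = fps_to_fls (1 + fps_X ^ k * h)"
    by (rule arg_cong)
  hence "fps_to_fls h * (1 - fls_X ^ k) = 1"
    by (simp add: fls_times_fps_to_fls fps_to_fls_power algebra_simps)
  moreover have "1 - fls_X ^ k \<noteq> (0 :: 'a fls)"
    using calculation by auto
  ultimately have "1 / (1 - fls_X ^ k) = fps_to_fls h"
    by (simp add: divide_eq_eq)
  moreover have "fps_to_fls h \<in> nonneg_series"
    by (rule nonneg_seriesI) (simp add: h_def)
  ultimately show ?thesis by simp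
qed

lemmas nonneg_series_intros = nonneg_series_0 nonneg_series_1 nonneg_series_X nonneg_series_add
  nonneg_series_mult nonneg_series_numeral nonneg_series_power nonneg_series_sum

lemma nonneg_series_lambert:
  assumes "k > 0"
  shows "fls_X ^ k / (1 - fls_X ^ k) \<in> nonneg_series"
  using nonneg_series_mult[OF nonneg_series_power[OF nonneg_series_X, of k] nonneg_series_geometric[OF assms]]
  by simp

lemma nonneg_series_coth:
  assumes "w > 0"
  shows "coth_series w - 1 \<in> (nonneg_series :: 'a::linordered_field fls set)"
    and "coth_series w \<in> (nonneg_series :: 'a fls set)"
proof -
  have nz: "1 - fls_X ^ (2 * w) \<noteq> (0 :: 'a fls)"
    by (rule x_power_nonzero) (use assms in simp)
  have eq: "coth_series w = 1 + 2 * (fls_X ^ (2 * w) / (1 - fls_X ^ (2 * w)) :: 'a fls)"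
    using nz by (simp add: coth_series_def divide_simps)
  have *: "2 * (fls_X ^ (2 * w) / (1 - fls_X ^ (2 * w))) \<in> (nonneg_series :: 'a fls set)"
    by (intro nonneg_series_mult nonneg_series_numeral nonneg_series_lambert) (use assms in simp)
  thus "coth_series w - 1 \<in> (nonneg_series :: 'a fls set)"
    unfolding eq add_diff_cancel_left' .
  show "coth_series w \<in> (nonneg_series :: 'a fls set)"
    unfolding eq by (rule nonneg_series_add[OF nonneg_series_1 *])
qed

lemma nonneg_series_X_powi: "n \<ge> 0 \<Longrightarrow> fls_X powi n \<in> nonneg_series"
  unfolding power_int_def by (simp add: nonneg_series_power nonneg_series_X)

lemma hecke_sum_nth_pos:
  assumes "0 < n" "n \<le> K"
  shows "fls_nth (hecke_sum K :: 'a::linordered_field fls) (int n) > 0"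
proof -
  \<comment> \<open>One occurrence of the n-th power suffices, as all else is nonnegative. For even
    \<open>n\<close>, the Lambert term with \<open>2 w = n\<close> has it; for odd \<open>n\<close>,
    \<open>n = 2 w - 1 = w^2 - (w - 1)^2\<close> is an exponent of the inner sum.\<close>
  define w where "w = (n + 1) div 2"
  have w: "w \<in> {1..K}"
    using assms by (auto simp: w_def)
  define a where "a v = fls_X ^ (2 * v) / (1 - fls_X ^ (2 * v) :: 'a fls)" for v
  define b where "b v = (\<Sum>t\<in>{- int v<..<int v}. fls_X powi ((int v)\<^sup>2 - t\<^sup>2) :: 'a fls)" for v
  have a: "a v \<in> nonneg_series" if "v \<in> {1..K}" for v
    unfolding a_def by (rule nonneg_series_lambert) (use that in simp)
  have b: "b v \<in> nonneg_series" for v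
    unfolding b_def by (intro nonneg_series_sum nonneg_series_X_powi square_diff_nonneg)
  have c: "coth_series v \<in> (nonneg_series :: 'a fls set)" "coth_series v - 1 \<in> (nonneg_series :: 'a fls set)"
    if "v \<in> {1..K}" for v
    by (rule nonneg_series_coth; use that in simp)+
  have term_nonneg: "4 * a v + 2 * coth_series v * b v \<in> nonneg_series" if "v \<in> {1..K}" for v
    by (intro nonneg_series_intros a b c that)
  have "hecke_sum K = 4 * a w + 2 * coth_series w * b w + (\<Sum>v\<in>{1..K} - {w}. 4 * a v + 2 * coth_series v * b v)"
    unfolding hecke_sum_eq a_def [symmetric] b_def [symmetric] by (rule sum.remove) (use w in auto)
  moreover have "\<exists>r \<in> nonneg_series. 4 * a w + 2 * coth_series w * b w = 2 * fls_X ^ n + r"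
  proof (cases "even n")
    case True
    hence "2 * w = n" by (auto simp: w_def)
    have nz: "1 - fls_X ^ n \<noteq> (0 :: 'a fls)"
      by (rule x_power_nonzero) fact
    have "a w = fls_X ^ n + fls_X ^ n * (fls_X ^ n / (1 - fls_X ^ n))"
      unfolding a_def \<open>2 * w = n\<close> using nz by (simp add: add_divide_eq_iff right_diff_distrib)
    hence "4 * a w + 2 * coth_series w * b w =
      2 * fls_X ^ n + (2 * fls_X ^ n + 4 * (fls_X ^ n * (fls_X ^ n / (1 - fls_X ^ n))) + 2 * coth_series w * b w)"
      by (simp add: distrib_left)
    thus ?thesis
      by (rule bexI) (intro nonneg_series_intros nonneg_series_lambert b c w assms)
  next
    case False
    define t where "t = int w - 1"
    have n: "int n = 2 * int w - 1"
      using False by (auto simp: w_def elim!: oddE)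
    have t: "t \<in> {- int w<..<int w}"
      using w by (auto simp: t_def)
    have e: "(int w)\<^sup>2 - t\<^sup>2 = int n"
      by (simp add: n t_def power2_eq_square algebra_simps)
    have "b w = fls_X ^ n + (\<Sum>t\<in>{- int w<..<int w} - {t}. fls_X powi ((int w)\<^sup>2 - t\<^sup>2))"
      unfolding b_def by (subst sum.remove[OF _ t]) (simp_all add: e del: fls_X_power_int)
    hence "4 * a w + 2 * coth_series w * b w =
      2 * fls_X ^ n + (4 * a w + 2 * (coth_series w - 1) * fls_X ^ n +
        2 * coth_series w * (\<Sum>t\<in>{- int w<..<int w} - {t}. fls_X powi ((int w)\<^sup>2 - t\<^sup>2)))"
      by (simp add: algebra_simps)
    thus ?thesis
      by (rule bexI) (intro nonneg_series_intros nonneg_series_X_powi square_diff_nonneg a c w; auto)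
  qed
  ultimately obtain r where "r \<in> nonneg_series"
    "hecke_sum K = 2 * fls_X ^ n + r + (\<Sum>v\<in>{1..K} - {w}. 4 * a v + 2 * coth_series v * b v)"
    by auto
  moreover have "(\<Sum>v\<in>{1..K} - {w}. 4 * a v + 2 * coth_series v * b v) \<in> nonneg_series"
    by (intro nonneg_series_sum term_nonneg) auto
  moreover have "fls_nth (2 * fls_X ^ n :: 'a fls) (int n) = 2"
    by simp
  ultimately show ?thesis
    using nonneg_series_nth[of r "int n"] nonneg_series_nth[of "\<Sum>v\<in>{1..K} - {w}. 4 * a v + 2 * coth_series v * b v" "int n"]
    by simp
qed

section \<open>Signed counts of overpartitions\<close>

definition bounded_overpartitions :: "nat \<Rightarrow> nat \<Rightarrow> (nat \<times> bool) list set" where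
  "bounded_overpartitions m n = {p. is_overpartition n p \<and> (\<forall>k \<in> set (map fst p). k \<le> m)}"

text \<open>As the parts are sorted, the first entry holds the largest part and tells whether that
  part is overlined.\<close>

definition headed_overpartitions :: "nat \<Rightarrow> bool \<Rightarrow> nat \<Rightarrow> (nat \<times> bool) list set" where
  "headed_overpartitions m b n = {p. is_overpartition n p \<and> p \<noteq> [] \<and> hd p = (m, b)}"

text \<open>The head has no predecessor, so \<open>b\<close> is free; the only new restriction on
  the tail's overlines is that no later copy of \<open>m\<close> is overlined.\<close>

lemma is_overpartition_Cons:
  "is_overpartition n ((m, b) # p) \<longleftrightarrow>
     0 < m \<and> m \<le> n \<and> is_overpartition (n - m) p \<and> (\<forall>k \<in> set (map fst p). k \<le> m) \<and> (m, True) \<notin> set p"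
  (is "?L \<longleftrightarrow> ?R")
proof -
  have first: "(\<forall>i < length ((m, b) # p). snd (((m, b) # p) ! i) \<longrightarrow>
      (\<forall>j < i. fst (((m, b) # p) ! j) \<noteq> fst (((m, b) # p) ! i))) \<longleftrightarrow>
    (m, True) \<notin> set p \<and>
    (\<forall>i < length p. snd (p ! i) \<longrightarrow> (\<forall>j < i. fst (p ! j) \<noteq> fst (p ! i)))"
    (is "(\<forall>i < _. ?Q i) \<longleftrightarrow> _")
  proof -
    have "(\<forall>i < length ((m, b) # p). ?Q i) \<longleftrightarrow> (\<forall>i < length p. ?Q (Suc i))"
      by (simp add: All_less_Suc2)
    also have "\<dots> \<longleftrightarrow> (\<forall>i < length p. snd (p ! i) \<longrightarrow> m \<noteq> fst (p ! i) \<and> (\<forall>j < i. fst (p ! j) \<noteq> fst (p ! i)))"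
      by (simp add: All_less_Suc2)
    also have "\<dots> \<longleftrightarrow> (\<forall>i < length p. snd (p ! i) \<longrightarrow> m \<noteq> fst (p ! i)) \<and>
       (\<forall>i < length p. snd (p ! i) \<longrightarrow> (\<forall>j < i. fst (p ! j) \<noteq> fst (p ! i)))"
      by blast
    also have "(\<forall>i < length p. snd (p ! i) \<longrightarrow> m \<noteq> fst (p ! i)) \<longleftrightarrow> (m, True) \<notin> set p"
      by (force simp: in_set_conv_nth prod_eq_iff)
    finally show ?thesis .
  qed
  have "sum_list (map fst ((m, b) # p)) = n \<longleftrightarrow> m \<le> n \<and> sum_list (map fst p) = n - m"
    by auto
  thus ?thesis
    unfolding is_overpartition_def first by auto
qed

lemma Cons_headed_overpartitions:
  assumes "p \<in> headed_overpartitions m b n"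
  obtains p' where "p = (m, b) # p'"
  using assms by (cases p) (auto simp: headed_overpartitions_def)

lemma headed_overpartitions_bound:
  assumes "p \<in> headed_overpartitions m b n" "k \<in> set (map fst p)"
  shows "k \<le> m"
  using assms by (cases p) (auto simp: headed_overpartitions_def is_overpartition_Cons)

lemma headed_overpartitions_empty:
  "n < m \<Longrightarrow> headed_overpartitions m b n = {}"
proof -
  assume "n < m"
  hence "p \<notin> headed_overpartitions m b n" for p
    by (cases p) (auto simp: headed_overpartitions_def is_overpartition_Cons)
  thus ?thesis by blast
qed

lemma bounded_overpartitions_split:
  assumes "m > 0"
  shows "bounded_overpartitions m n = bounded_overpartitions (m - 1) n \<union>
    (headed_overpartitions m True n \<union> headed_overpartitions m False n)"
proof (intro equalityI subsetI)
  fix p assume p: "p \<in> bounded_overpartitions m n"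
  show "p \<in> bounded_overpartitions (m - 1) n \<union>
    (headed_overpartitions m True n \<union> headed_overpartitions m False n)"
  proof (cases p)
    case Nil
    thus ?thesis using p by (auto simp: bounded_overpartitions_def)
  next
    case (Cons a p')
    obtain l b where a: "a = (l, b)" by (cases a)
    show ?thesis
    proof (cases "l = m")
      case True
      thus ?thesis
        using p Cons a by (cases b) (auto simp: bounded_overpartitions_def headed_overpartitions_def)
    next
      case False
      hence "l < m" using p Cons a by (auto simp: bounded_overpartitions_def)
      moreover have "\<forall>k \<in> set (map fst p). k \<le> l"
        using p Cons a by (auto simp: bounded_overpartitions_def is_overpartition_Cons)
      ultimately have "\<forall>k \<in> set (map fst p). k \<le> m - 1" by auto
      thus ?thesis using p by (simp add: bounded_overpartitions_def)
    qed
  qed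
next
  fix p assume p: "p \<in> bounded_overpartitions (m - 1) n \<union>
    (headed_overpartitions m True n \<union> headed_overpartitions m False n)"
  have "k \<le> m" if "k \<in> set (map fst p)" for k
  proof (cases "p \<in> bounded_overpartitions (m - 1) n")
    case True
    hence "k \<le> m - 1" using that by (auto simp: bounded_overpartitions_def)
    thus ?thesis by simp
  next
    case False
    thus ?thesis using p that headed_overpartitions_bound by blast
  qed
  moreover have "is_overpartition n p"
    using p by (auto simp: bounded_overpartitions_def headed_overpartitions_def)
  ultimately show "p \<in> bounded_overpartitions m n"
    by (simp add: bounded_overpartitions_def)
qed

text \<open>After the head is deleted, the rest has only parts below \<open>m\<close> or begins with
  a copy of \<open>m\<close> that is not overlined. These remainders do not depend on
  \<open>b\<close>, whence the factor 2 in \<open>bounded_count_eq\<close>.\<close>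

lemma headed_overpartitions_eq:
  assumes "0 < m" "m \<le> n"
  shows "headed_overpartitions m b n =
    Cons (m, b) ` (bounded_overpartitions (m - 1) (n - m) \<union> headed_overpartitions m False (n - m))"
proof -
  have "is_overpartition (n - m) p \<and> (\<forall>k \<in> set (map fst p). k \<le> m) \<and> (m, True) \<notin> set p \<longleftrightarrow>
     p \<in> bounded_overpartitions (m - 1) (n - m) \<union> headed_overpartitions m False (n - m)" for p
  proof
    assume p: "is_overpartition (n - m) p \<and> (\<forall>k \<in> set (map fst p). k \<le> m) \<and> (m, True) \<notin> set p"
    hence "p \<in> bounded_overpartitions m (n - m)"
      by (simp add: bounded_overpartitions_def)
    moreover have "p \<notin> headed_overpartitions m True (n - m)"
      using p by (auto elim!: Cons_headed_overpartitions)
    ultimately show "p \<in> bounded_overpartitions (m - 1) (n - m) \<union> headed_overpartitions m False (n - m)"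
      using bounded_overpartitions_split[OF assms(1)] by blast
  next
    assume p: "p \<in> bounded_overpartitions (m - 1) (n - m) \<union> headed_overpartitions m False (n - m)"
    hence "p \<in> bounded_overpartitions m (n - m)"
      using bounded_overpartitions_split[OF assms(1)] by blast
    moreover have "(m, True) \<notin> set p"
    proof (cases "p \<in> bounded_overpartitions (m - 1) (n - m)")
      case True
      thus ?thesis
        using assms(1) by (force simp: bounded_overpartitions_def)
    next
      case False
      hence "p \<in> headed_overpartitions m False (n - m)"
        using p by blast
      thus ?thesis
        by (cases p) (auto simp: headed_overpartitions_def is_overpartition_Cons)
    qed
    ultimately show "is_overpartition (n - m) p \<and> (\<forall>k \<in> set (map fst p). k \<le> m) \<and> (m, True) \<notin> set p"
      by (simp add: bounded_overpartitions_def)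
  qed
  hence *: "is_overpartition n ((m, b) # p) \<longleftrightarrow>
    p \<in> bounded_overpartitions (m - 1) (n - m) \<union> headed_overpartitions m False (n - m)" for p
    using assms by (simp add: is_overpartition_Cons)
  show ?thesis
  proof (intro equalityI subsetI)
    fix p assume p: "p \<in> headed_overpartitions m b n"
    then obtain p' where p': "p = (m, b) # p'" by (rule Cons_headed_overpartitions)
    with p show "p \<in> Cons (m, b) ` (bounded_overpartitions (m - 1) (n - m) \<union> headed_overpartitions m False (n - m))"
      using * by (auto simp: headed_overpartitions_def)
  qed (use * in \<open>auto simp: headed_overpartitions_def\<close>)
qed

lemma finite_bounded_overpartitions [simp]: "finite (bounded_overpartitions m n)"
  and finite_headed_overpartitions [simp]: "finite (headed_overpartitions m b n)"
  by (rule finite_subset[OF _ finite_overpartitions];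
      auto simp: bounded_overpartitions_def headed_overpartitions_def)+

lemma bounded_headed_disjoint:
  "m > 0 \<Longrightarrow> bounded_overpartitions (m - 1) n \<inter> headed_overpartitions m b n' = {}"
  by (auto elim!: Cons_headed_overpartitions simp: bounded_overpartitions_def)

section \<open>Counts signed by the number of parts, and their generating functions\<close>

definition bounded_count :: "nat \<Rightarrow> nat \<Rightarrow> rat" where
  "bounded_count m n = (\<Sum>p\<in>bounded_overpartitions m n. (-1) ^ length p)"

definition headed_count :: "nat \<Rightarrow> nat \<Rightarrow> rat" where
  "headed_count m n = (\<Sum>p\<in>headed_overpartitions m False n. (-1) ^ length p)"

lemma sum_headed_overpartitions:
  assumes "0 < m"
  shows "(\<Sum>p\<in>headed_overpartitions m b n. (-1) ^ length p) =
    (if n < m then 0 else - (bounded_count (m - 1) (n - m) + headed_count m (n - m)))"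
proof (cases "n < m")
  case False
  have "(\<Sum>p\<in>headed_overpartitions m b n. (-1) ^ length p :: rat) =
    (\<Sum>p\<in>bounded_overpartitions (m - 1) (n - m) \<union> headed_overpartitions m False (n - m). (-1) ^ length ((m, b) # p))"
    using False by (subst headed_overpartitions_eq[OF assms]) (simp_all add: sum.reindex)
  also have "\<dots> = - (bounded_count (m - 1) (n - m) + headed_count m (n - m))"
    using bounded_headed_disjoint[OF assms, of "n - m" False "n - m"]
    by (simp add: bounded_count_def headed_count_def sum_negf sum.union_disjoint)
  finally show ?thesis
    using False by simp
qed (simp add: headed_overpartitions_empty)

lemma headed_count_eq:
  "0 < m \<Longrightarrow> headed_count m n = (if n < m then 0 else - (bounded_count (m - 1) (n - m) + headed_count m (n - m)))"
  unfolding headed_count_def[of m n] by (rule sum_headed_overpartitions)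

lemma sum_headed_overpartitions_eq:
  "0 < m \<Longrightarrow> (\<Sum>p\<in>headed_overpartitions m b n. (-1) ^ length p) = headed_count m n"
  using sum_headed_overpartitions[of m b n] headed_count_eq[of m n] by simp

lemma headed_disjoint:
  "m \<noteq> m' \<or> b \<noteq> b' \<Longrightarrow> headed_overpartitions m b n \<inter> headed_overpartitions m' b' n' = {}"
  by (auto simp: headed_overpartitions_def)

lemma bounded_count_eq:
  assumes "0 < m"
  shows "bounded_count m n = bounded_count (m - 1) n + 2 * headed_count m n"
proof -
  have "(\<Sum>p\<in>headed_overpartitions m True n \<union> headed_overpartitions m False n. (-1) ^ length p) = 2 * headed_count m n"
    by (simp add: sum.union_disjoint headed_disjoint sum_headed_overpartitions_eq[OF assms])
  moreover have "bounded_overpartitions (m - 1) n \<inter> (headed_overpartitions m True n \<union> headed_overpartitions m False n) = {}"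
    using bounded_headed_disjoint[OF assms] by blast
  ultimately show ?thesis
    unfolding bounded_count_def bounded_overpartitions_split[OF assms]
    by (simp add: sum.union_disjoint)
qed

lemma bounded_count_0: "bounded_count 0 n = (if n = 0 then 1 else 0)"
proof -
  have "bounded_overpartitions 0 n = (if n = 0 then {[]} else {})"
  proof -
    have "p \<in> bounded_overpartitions 0 n \<longleftrightarrow> p = [] \<and> n = 0" for p
      by (cases p) (auto simp: bounded_overpartitions_def is_overpartition_def)
    thus ?thesis by auto
  qed
  thus ?thesis by (simp add: bounded_count_def)
qed

lemma headed_overpartitions_rank:
  assumes "p \<in> headed_overpartitions m b n"
  shows "overpartition_rank p = int m - int (length p)"
proof -
  obtain p' where p': "p = (m, b) # p'"
    using assms by (rule Cons_headed_overpartitions)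
  have "Max (set (map fst p)) = m"
    using headed_overpartitions_bound[OF assms] p' by (intro Max_eqI) auto
  thus ?thesis by (simp add: overpartition_rank_def)
qed

text \<open>The sign of the rank is \<open>(-1) ^ m * (-1) ^ length p\<close>, and the 2 accounts
  for a plain or overlined largest part. \<open>n > 0\<close> excludes the empty list, whose rank is
  unspecified.\<close>

lemma Nbar_diff:
  assumes "n > 0"
  shows "of_nat (Nbar 0 2 n) - of_nat (Nbar 1 2 n) = (\<Sum>m=1..n. 2 * (-1) ^ m * headed_count m n)"
proof -
  define A where "A = {p. is_overpartition n p}"
  have A: "A = (\<Union>(m, b)\<in>{1..n} \<times> UNIV. headed_overpartitions m b n)"
  proof (intro equalityI subsetI)
    fix p assume p: "p \<in> A"
    hence "p \<noteq> []" using assms by (auto simp: A_def is_overpartition_def)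
    then obtain m b p' where p': "p = (m, b) # p'" by (cases p) auto
    hence "p \<in> headed_overpartitions m b n" "m \<in> {1..n}"
      using p by (auto simp: A_def headed_overpartitions_def is_overpartition_Cons)
    thus "p \<in> (\<Union>(m, b)\<in>{1..n} \<times> UNIV. headed_overpartitions m b n)" by blast
  qed (auto simp: A_def headed_overpartitions_def)
  have fin: "finite A"
    unfolding A_def by (rule finite_overpartitions)
  define s :: "(nat \<times> bool) list \<Rightarrow> rat" where "s p = (if even (overpartition_rank p) then 1 else -1)" for p
  have "of_nat (Nbar 0 2 n) - of_nat (Nbar 1 2 n) = (\<Sum>p\<in>A. s p)"
  proof -
    have "{p. is_overpartition n p \<and> [overpartition_rank p = 0] (mod 2)} = {p \<in> A. even (overpartition_rank p)}"
      "{p. is_overpartition n p \<and> [overpartition_rank p = 1] (mod 2)} = {p \<in> A. \<not> even (overpartition_rank p)}"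
      by (auto simp: A_def cong_def even_iff_mod_2_eq_zero odd_iff_mod_2_eq_one)
    hence "Nbar 0 2 n = card {p \<in> A. even (overpartition_rank p)}"
      "Nbar 1 2 n = card {p \<in> A. \<not> even (overpartition_rank p)}"
      by (simp_all add: Nbar_def)
    moreover have "(\<Sum>p\<in>A. s p) = (\<Sum>p\<in>A. (if even (overpartition_rank p) then 1 else 0) - (if \<not> even (overpartition_rank p) then 1 else 0))"
      by (intro sum.cong) (auto simp: s_def)
    moreover have "\<dots> = of_nat (card {p \<in> A. even (overpartition_rank p)}) - of_nat (card {p \<in> A. \<not> even (overpartition_rank p)})"
      using fin by (simp add: sum_subtractf sum.If_cases Int_def)
    ultimately show ?thesis by simp
  qed
  also have "\<dots> = (\<Sum>i\<in>{1..n} \<times> UNIV. \<Sum>p\<in>headed_overpartitions (fst i) (snd i) n. s p)"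
    unfolding A case_prod_unfold
  proof (rule sum.UNION_disjoint)
    show "\<forall>i\<in>{1..n} \<times> UNIV. \<forall>j\<in>{1..n} \<times> UNIV. i \<noteq> j \<longrightarrow>
      headed_overpartitions (fst i) (snd i) n \<inter> headed_overpartitions (fst j) (snd j) n = {}"
      by (auto simp: headed_overpartitions_def prod_eq_iff)
  qed auto
  also have "\<dots> = (\<Sum>i\<in>{1..n} \<times> (UNIV :: bool set). (-1) ^ fst i * headed_count (fst i) n)"
  proof (intro sum.cong refl)
    fix i :: "nat \<times> bool" assume "i \<in> {1..n} \<times> UNIV"
    then obtain m b where i: "i = (m, b)" and m: "m > 0" by (cases i) auto
    have "(\<Sum>p\<in>headed_overpartitions m b n. s p) = (\<Sum>p\<in>headed_overpartitions m b n. (-1) ^ m * (-1) ^ length p)"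
      by (intro sum.cong refl) (auto simp: s_def headed_overpartitions_rank)
    also have "\<dots> = (-1) ^ m * headed_count m n"
      using sum_headed_overpartitions_eq[OF m, of b n] by (simp flip: sum_distrib_left)
    finally show "(\<Sum>p\<in>headed_overpartitions (fst i) (snd i) n. s p) = (-1) ^ fst i * headed_count (fst i) n"
      by (simp add: i)
  qed
  also have "\<dots> = (\<Sum>m=1..n. \<Sum>b\<in>(UNIV :: bool set). (-1) ^ m * headed_count m n)"
    by (simp only: sum.cartesian_product case_prod_unfold)
  also have "\<dots> = (\<Sum>m=1..n. 2 * (-1) ^ m * headed_count m n)"
    by (simp add: UNIV_bool mult.assoc)
  finally show ?thesis .
qed

text \<open>The sign \<open>(-1) ^ n\<close> performs the substitution
  \<open>q = - x\<close>.\<close>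

definition bounded_series :: "nat \<Rightarrow> rat fps" where
  "bounded_series m = Abs_fps (\<lambda>n. (-1) ^ n * bounded_count m n)"

definition headed_series :: "nat \<Rightarrow> rat fps" where
  "headed_series m = Abs_fps (\<lambda>n. (-1) ^ n * headed_count m n)"

lemma bounded_series_eq:
  assumes "m > 0"
  shows "bounded_series m = bounded_series (m - 1) + 2 * headed_series m"
proof (rule fps_ext)
  have *: "(2 :: rat fps) = fps_const 2"
    by (simp add: numeral_fps_const)
  fix n show "fps_nth (bounded_series m) n = fps_nth (bounded_series (m - 1) + 2 * headed_series m) n"
    unfolding * by (simp add: bounded_series_def headed_series_def bounded_count_eq[OF assms] algebra_simps)
qed

text \<open>Removing one largest part accounts for the factor \<open>q ^ m\<close> with
  \<open>q = - x\<close>, and for the minus sign, since the length changes parity.\<close>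

lemma headed_series_eq:
  assumes "m > 0"
  shows "headed_series m = - ((- fps_X) ^ m * (bounded_series (m - 1) + headed_series m))"
proof (rule fps_ext)
  fix n
  have sign: "fps_nth ((-1) ^ m * f) n = (-1) ^ m * fps_nth f n" for f :: "rat fps"
    by (cases "even m") simp_all
  have "fps_nth ((- fps_X) ^ m * (bounded_series (m - 1) + headed_series m)) n =
    (-1) ^ m * (if n < m then 0 else fps_nth (bounded_series (m - 1) + headed_series m) (n - m))"
    unfolding power_minus[of fps_X] mult.assoc sign fps_X_power_mult_nth ..
  also have "\<dots> = - ((-1) ^ n * headed_count m n)"
  proof (cases "n < m")
    case False
    hence 1: "(-1 :: rat) ^ n = (-1) ^ m * (-1) ^ (n - m)"
      by (simp flip: power_add)
    have 2: "headed_count m n = - (bounded_count (m - 1) (n - m) + headed_count m (n - m))"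
      using False headed_count_eq[OF assms, of n] by simp
    show ?thesis
      unfolding 1 2 using False by (simp add: bounded_series_def headed_series_def algebra_simps)
  qed (simp add: headed_count_eq[OF assms])
  finally show "fps_nth (headed_series m) n =
    fps_nth (- ((- fps_X) ^ m * (bounded_series (m - 1) + headed_series m))) n"
    by (simp add: headed_series_def)
qed

text \<open>Solving the linear equation for the headed series \<open>H\<close> gives
  \<open>B + 2 H = B (1 - y) / (1 + y)\<close> with \<open>y = q ^ Suc m\<close>, the next factor of
  the product.\<close>

lemma bounded_series_eq_theta_ratio: "fps_to_fls (bounded_series m) = theta_ratio (- fls_X) m"
proof (induction m)
  case 0
  have "bounded_series 0 = 1"
    by (rule fps_ext) (simp add: bounded_series_def bounded_count_0)
  thus ?case by (simp add: theta_ratio_def)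
next
  case (Suc m)
  define y where "y = (- fls_X :: rat fls) ^ Suc m"
  define B where "B = fps_to_fls (bounded_series m)"
  define H where "H = fps_to_fls (headed_series (Suc m))"
  have y: "1 + y \<noteq> 0"
    unfolding y_def by (rule nome_nonzero[OF q_nome]) simp
  from arg_cong[where f = fps_to_fls, OF headed_series_eq[OF zero_less_Suc, of m]]
  have "H = - (y * (B + H))"
    unfolding fps_to_fls_uminus fls_times_fps_to_fls fps_to_fls_power fps_to_fls_plus fps_X_to_fls
      diff_Suc_1 H_def [symmetric] B_def [symmetric] y_def [symmetric] .
  hence "H + y * (B + H) = 0"
    by (simp only: eq_neg_iff_add_eq_0)
  hence "(1 + y) * H + y * B = 0"
    by (simp only: distrib_left distrib_right mult_1 ac_simps)
  moreover have "(1 + y) * (B + 2 * H) = (1 - y) * B + 2 * ((1 + y) * H + y * B)"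
    by (simp add: algebra_simps)
  ultimately have "(1 + y) * (B + 2 * H) = (1 - y) * B"
    by (simp only: mult_zero_right add_0_right)
  moreover have "fps_to_fls (bounded_series (Suc m)) = B + 2 * H"
    using bounded_series_eq[OF zero_less_Suc, of m]
    by (simp add: B_def H_def fls_times_fps_to_fls)
  ultimately have "fps_to_fls (bounded_series (Suc m)) = B * ((1 - y) / (1 + y))"
    using y by (simp add: eq_divide_eq mult.commute)
  thus ?case
    using Suc.IH by (simp add: B_def y_def theta_ratio_def)
qed

theorem theorem3:
  fixes n :: nat
  assumes "n \<ge> 1"
  shows "(odd n \<longrightarrow> Nbar 0 2 n > Nbar 1 2 n) \<and>
         (even n \<longrightarrow> Nbar 0 2 n < Nbar 1 2 n)"
proof -
  \<comment> \<open>A congruence modulo \<open>fls_X ^ K\<close> determines the coefficients below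
    \<open>K\<close>, so \<open>K\<close> has to exceed \<open>n\<close>. The extra summand
    \<open>m = Suc n\<close> contributes \<open>headed_count (Suc n) n = 0\<close>.\<close>
  define K where "K = Suc n"
  define q :: "rat fls" where "q = - fls_X"
  define G where "G = 1 + (\<Sum>m=1..K. (-1) ^ m * (theta_ratio q m - theta_ratio q (m - 1)))"
  have "theta_ratio q m - theta_ratio q (m - 1) = 2 * fps_to_fls (headed_series m)" if "m \<in> {1..K}" for m
  proof -
    from that have "m > 0" by simp
    from arg_cong[where f = fps_to_fls, OF bounded_series_eq[OF this]]
    have "theta_ratio q m = theta_ratio q (m - 1) + 2 * fps_to_fls (headed_series m)"
      unfolding fps_to_fls_plus fls_times_fps_to_fls fps_to_fls_numeral bounded_series_eq_theta_ratio
        q_def [symmetric] .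
    hence "theta_ratio q m - theta_ratio q (m - 1) =
      theta_ratio q (m - 1) + 2 * fps_to_fls (headed_series m) - theta_ratio q (m - 1)"
      by (rule arg_cong)
    thus ?thesis unfolding add_diff_cancel_left' .
  qed
  hence G: "G = 1 + (\<Sum>m=1..K. (-1) ^ m * (2 * fps_to_fls (headed_series m)))"
    unfolding G_def by (intro arg_cong2[where f = "(+)"] sum.cong arg_cong2[where f = "(*)"] refl)
  have sign: "fls_nth ((-1) ^ m * (2 * f)) k = (-1) ^ m * (2 * fls_nth f k)" for m k and f :: "rat fls"
    unfolding mult_2 by (cases "even m") simp_all
  have "fls_nth G (int n) = (\<Sum>m=1..K. (-1) ^ m * (2 * ((-1) ^ n * headed_count m n)))"
    using assms unfolding G fls_nth_sum sign fls_plus_nth by (simp add: headed_series_def)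
  also have "\<dots> = (-1) ^ n * (\<Sum>m=1..n. 2 * (-1) ^ m * headed_count m n)"
  proof -
    have "headed_count (Suc n) n = 0"
      using headed_count_eq[of "Suc n" n] by simp
    thus ?thesis
      by (simp add: K_def sum_distrib_left mult_ac)
  qed
  also have "\<dots> = (-1) ^ n * (of_nat (Nbar 0 2 n) - of_nat (Nbar 1 2 n))"
    using Nbar_diff[of n] assms by simp
  finally have "(-1) ^ n * (of_nat (Nbar 0 2 n) - of_nat (Nbar 1 2 n)) = fls_nth G (int n)" ..
  also have "fls_nth G (int n) = fls_nth (1 - hecke_sum K) (int n)"
    unfolding G_def q_def
    by (rule X_cong_nth[OF alternating_theta_ratio_cong_hecke_sum]) (simp add: K_def)
  also have "\<dots> < 0"
    using hecke_sum_nth_pos[of n K, where 'a = rat] assms by (simp add: K_def)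
  finally have "(-1) ^ n * (of_nat (Nbar 0 2 n) - of_nat (Nbar 1 2 n)) < (0 :: rat)" .
  thus ?thesis
    by (cases "even n") auto
qed

end
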